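(* Let $R(\lambda)$ be an $s\times s$ matrix ($s\ge1$) whose entries are rational functions in $\lambda$ with complex coefficients, the degree of each numerator not exceeding the degree of its denominator. Then $R$ has an unfolding. Furthermore, $R$ has a Hermitian unfolding if and only if all of the following hold: (i) every pole of every entry of $R$ is real and simple; (ii) for each such pole $\nu$, the residue matrix of $R$ at $\nu$ (whose $(i,j)$ entry is the residue of $R_{i,j}(\lambda)$ at $\nu$) is positive semidefinite; (iii) $\lim_{\lambda\to\infty}R(\lambda)$ is Hermitian.
   Context: For a square complex matrix $A=\begin{bmatrix} M & C \\ D & F \end{bmatrix}$ with the $M$ block indexed by a subset $S$ of the index set, the isospectral reduction of $A$ to $S$ is $\mathcal{R}(\lambda,S,A)=M+C(\lambda I-F)^{-1}D$. An unfolding of an $s\times s$ matrix $R$ of rational functions in $\lambda$ is a matrix $A\in\mathbb{C}^{n\times n}$, for some $n>s$, together with a subset $S$ of its index set with $|S|=s$, such that $\mathcal{R}(\lambda,S,A)=R$. The unfolding is Hermitian if $A$ is Hermitian. Positive semidefinite includes Hermitian. *)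

theory Defs
  imports
    "HOL-Complex_Analysis.Complex_Analysis"
    "HOL-Computational_Algebra.Normalized_Fraction"
    "HOL-Computational_Algebra.Polynomial_Factorial"
    "HOL-Computational_Algebra.Field_as_Ring"
    "Jordan_Normal_Form.DL_Submatrix"
    "Jordan_Normal_Form.Gauss_Jordan_Elimination"
    "Jordan_Normal_Form.Schur_Decomposition"
begin

text \<open>Rational functions in \<open>\<lambda>\<close> are elements of the field \<^typ>\<open>complex poly fract\<close>;
  \<^const>\<open>quot_of_fract\<close> yields numerator and denominator in lowest terms.\<close>

definition proper_ratfun :: "complex poly fract \<Rightarrow> bool" where
  "proper_ratfun f \<longleftrightarrow>
     degree (fst (quot_of_fract f)) \<le> degree (snd (quot_of_fract f))"

text \<open>At a pole the value is \<open>0\<close>, by division by zero. This is harmless below, since poles,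
  orders, residues and limits at infinity do not depend on it.\<close>

definition eval_ratfun :: "complex poly fract \<Rightarrow> complex \<Rightarrow> complex" where
  "eval_ratfun f z = poly (fst (quot_of_fract f)) z / poly (snd (quot_of_fract f)) z"

definition const_ratfun_mat :: "complex mat \<Rightarrow> complex poly fract mat" where
  "const_ratfun_mat A = map_mat (\<lambda>c. to_fract [:c:]) A"

definition ratfun_var :: "complex poly fract" where
  "ratfun_var = to_fract [:0, 1:]"

text \<open>The rows and columns of each block are listed in the increasing order of their indices.
  The matrix \<open>\<lambda>I - F\<close> is always invertible over the field of rational functions, as its
  determinant is the characteristic polynomial of \<open>F\<close>.\<close>

definition isospectral_reduction :: "nat set \<Rightarrow> complex mat \<Rightarrow> complex poly fract mat" where
  "isospectral_reduction S A =
     (let M = const_ratfun_mat (submatrix A S S);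
          C = const_ratfun_mat (submatrix A S (- S));
          D = const_ratfun_mat (submatrix A (- S) S);
          F = const_ratfun_mat (submatrix A (- S) (- S))
      in M + C * the (mat_inverse (ratfun_var \<cdot>\<^sub>m 1\<^sub>m (dim_row F) - F)) * D)"

definition is_unfolding :: "complex poly fract mat \<Rightarrow> complex mat \<Rightarrow> nat set \<Rightarrow> bool" where
  "is_unfolding R A S \<longleftrightarrow>
     (\<exists>n > dim_row R. A \<in> carrier_mat n n \<and> S \<subseteq> {..<n} \<and> card S = dim_row R \<and>
        isospectral_reduction S A = R)"

definition hermitian_mat :: "complex mat \<Rightarrow> bool" where
  "hermitian_mat A \<longleftrightarrow> square_mat A \<and> mat_adjoint A = A"

text \<open>The order on \<^typ>\<open>complex\<close> is the partial one: \<open>0 \<le> z\<close> means that \<open>z\<close> is real and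
  nonnegative.\<close>

definition psd_mat :: "complex mat \<Rightarrow> bool" where
  "psd_mat A \<longleftrightarrow> hermitian_mat A \<and>
     (\<forall>v \<in> carrier_vec (dim_row A). 0 \<le> conjugate v \<bullet> (A *\<^sub>v v))"

definition entry_pole :: "complex poly fract mat \<Rightarrow> nat \<Rightarrow> nat \<Rightarrow> complex \<Rightarrow> bool" where
  "entry_pole R i j \<nu> \<longleftrightarrow>
     i < dim_row R \<and> j < dim_col R \<and> is_pole (eval_ratfun (R $$ (i, j))) \<nu>"

definition residue_mat :: "complex poly fract mat \<Rightarrow> complex \<Rightarrow> complex mat" where
  "residue_mat R \<nu> =
     mat (dim_row R) (dim_col R) (\<lambda>(i, j). residue (eval_ratfun (R $$ (i, j))) \<nu>)"

definition mat_limit_at_infinity :: "complex poly fract mat \<Rightarrow> complex mat \<Rightarrow> bool" where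
  "mat_limit_at_infinity R L \<longleftrightarrow> L \<in> carrier_mat (dim_row R) (dim_col R) \<and>
     (\<forall>i < dim_row R. \<forall>j < dim_col R.
        ((eval_ratfun (R $$ (i, j))) \<longlongrightarrow> L $$ (i, j)) at_infinity)"

end

theory Submission
  imports Defs
begin

text \<open>An unfolding of \<open>R\<close> is a state-space realization: if \<open>(\<lambda>I - F) X = D\<close> over the field of
  rational functions, then \<open>M + C X\<close> is the isospectral reduction. Writing the entries of \<open>R\<close> over a
  common denominator \<open>q\<close> of positive degree \<open>d\<close>, one takes as states the rows \<open>(\<lambda>\<^sup>k / q) e\<^sub>j\<close> with
  \<open>k < d\<close>, whose span together with the constant rows is stable under multiplication by \<open>\<lambda>\<close>.
  If \<open>A\<close> is Hermitian, unitary diagonalization of \<open>F\<close> turns the reduction into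
  \<open>M + \<Sum>\<^sub>k g\<^sub>k g\<^sub>k\<^sup>* / (\<lambda> - d\<^sub>k)\<close> with real \<open>d\<^sub>k\<close>, from which the poles, the residues and the limit
  can be read off. Conversely, the three conditions give such an expansion, by partial fractions and
  by writing each positive semidefinite residue matrix as a sum of rank one terms \<open>g g\<^sup>*\<close>; the states
  \<open>g\<^sub>k\<^sup>* / (\<lambda> - d\<^sub>k)\<close> then realize it with a real diagonal \<open>F\<close> and \<open>D = C\<^sup>*\<close>.\<close>

section \<open>Hermitian and positive semidefinite matrices\<close>

lemma mat_mult_index:
  fixes A B :: "'a :: semiring_0 mat"
  assumes "A \<in> carrier_mat m n" "B \<in> carrier_mat n k" "i < m" "j < k"
  shows "(A * B) $$ (i, j) = (\<Sum>l<n. A $$ (i, l) * B $$ (l, j))"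
  using assms by (simp add: scalar_prod_def lessThan_atLeast0)

lemma mat_adjoint_carrier [simp]: "A \<in> carrier_mat n m \<Longrightarrow> mat_adjoint A \<in> carrier_mat m n"
  by (auto simp: mat_adjoint_def)

lemma dim_mat_adjoint [simp]:
  "dim_row (mat_adjoint A) = dim_col A" "dim_col (mat_adjoint A) = dim_row A"
  by (auto simp: mat_adjoint_def)

lemma mat_adjoint_index [simp]:
  assumes "i < dim_col A" "j < dim_row A"
  shows "mat_adjoint A $$ (i, j) = conjugate (A $$ (j, i))"
  using assms by (auto simp: mat_adjoint_def mat_of_rows_def)

lemma mat_adjoint_mult:
  fixes A B :: "complex mat"
  assumes "A \<in> carrier_mat n k" "B \<in> carrier_mat k m"
  shows "mat_adjoint (A * B) = mat_adjoint B * mat_adjoint A"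
proof (rule eq_matI)
  show "mat_adjoint (A * B) $$ (i, j) = (mat_adjoint B * mat_adjoint A) $$ (i, j)"
    if "i < dim_row (mat_adjoint B * mat_adjoint A)" "j < dim_col (mat_adjoint B * mat_adjoint A)" for i j
    using assms that by (auto simp: scalar_prod_def mult.commute)
qed (use assms in auto)

lemma mat_adjoint_mat_adjoint [simp]: "mat_adjoint (mat_adjoint A) = A"
  by (rule eq_matI) auto

lemma hermitian_mat_iff:
  assumes "A \<in> carrier_mat n n"
  shows "hermitian_mat A \<longleftrightarrow> (\<forall>i<n. \<forall>j<n. A $$ (i, j) = cnj (A $$ (j, i)))"
proof -
  have "mat_adjoint A = A \<longleftrightarrow> (\<forall>i<n. \<forall>j<n. mat_adjoint A $$ (i, j) = A $$ (i, j))"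
    using assms by (auto intro!: eq_matI simp del: mat_adjoint_index)
  also have "\<dots> \<longleftrightarrow> (\<forall>i<n. \<forall>j<n. A $$ (i, j) = cnj (A $$ (j, i)))"
  proof -
    have "mat_adjoint A $$ (i, j) = A $$ (i, j) \<longleftrightarrow> A $$ (i, j) = cnj (A $$ (j, i))"
      if "i < n" "j < n" for i j
    proof -
      have "mat_adjoint A $$ (i, j) = cnj (A $$ (j, i))" using assms that by simp
      then show ?thesis by (rule ssubst) (rule eq_commute)
    qed
    then show ?thesis by (intro all_cong1 imp_cong refl)
  qed
  finally show ?thesis
    using assms by (simp add: hermitian_mat_def)
qed

text \<open>Index functions \<open>x\<close> can replace the vectors, since only their values below
  \<open>n\<close> enter; the quadratic form is then a double sum.\<close>

lemma psd_mat_iff: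
  assumes A: "A \<in> carrier_mat n n"
  shows "psd_mat A \<longleftrightarrow> hermitian_mat A \<and>
    (\<forall>x. 0 \<le> (\<Sum>i<n. \<Sum>j<n. cnj (x i) * A $$ (i, j) * x j))"
proof -
  have *: "conjugate v \<bullet> (A *\<^sub>v v) = (\<Sum>i<n. \<Sum>j<n. cnj (v $ i) * A $$ (i, j) * v $ j)"
    if "v \<in> carrier_vec n" for v
    using A that by (auto simp: scalar_prod_def sum_distrib_left mult.assoc lessThan_atLeast0)
  have "(\<forall>v\<in>carrier_vec n. 0 \<le> conjugate v \<bullet> (A *\<^sub>v v)) \<longleftrightarrow>
    (\<forall>x. 0 \<le> (\<Sum>i<n. \<Sum>j<n. cnj (x i) * A $$ (i, j) * x j))"
  proof (intro iffI ballI allI)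
    fix x assume "\<forall>v\<in>carrier_vec n. 0 \<le> conjugate v \<bullet> (A *\<^sub>v v)"
    then have "0 \<le> conjugate (vec n x) \<bullet> (A *\<^sub>v vec n x)" by simp
    then show "0 \<le> (\<Sum>i<n. \<Sum>j<n. cnj (x i) * A $$ (i, j) * x j)"
      by (simp add: *)
  qed (use * in auto)
  then show ?thesis using A by (simp add: psd_mat_def)
qed

text \<open>The matrix is a sum of rank one terms g_k g_k^*. With y_k = x^* g_k, its quadratic form
  at x is the sum of the |y_k|^2.\<close>

lemma psd_mat_gram:
  assumes A: "A \<in> carrier_mat n n" and "finite K"
    and g: "\<And>i j. i < n \<Longrightarrow> j < n \<Longrightarrow> A $$ (i, j) = (\<Sum>k\<in>K. g i k * cnj (g j k))"
  shows "psd_mat A"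
proof -
  have "hermitian_mat A"
    unfolding hermitian_mat_iff[OF A]
  proof (intro allI impI)
    show "A $$ (i, j) = cnj (A $$ (j, i))" if "i < n" "j < n" for i j
      unfolding g[OF that] g[OF that(2,1)] by (simp add: mult.commute)
  qed
  moreover have "0 \<le> (\<Sum>i<n. \<Sum>j<n. cnj (x i) * A $$ (i, j) * x j)" for x
  proof -
    define y where "y k = (\<Sum>i<n. cnj (x i) * g i k)" for k
    have "(\<Sum>i<n. \<Sum>j<n. cnj (x i) * A $$ (i, j) * x j) =
        (\<Sum>i<n. \<Sum>j<n. \<Sum>k\<in>K. (cnj (x i) * g i k) * cnj (cnj (x j) * g j k))"
      by (intro sum.cong refl) (simp add: g sum_distrib_left sum_distrib_right mult_ac)
    also have "\<dots> = (\<Sum>i<n. \<Sum>k\<in>K. \<Sum>j<n. (cnj (x i) * g i k) * cnj (cnj (x j) * g j k))"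
      by (subst (2) sum.swap) simp
    also have "\<dots> = (\<Sum>k\<in>K. y k * cnj (y k))"
      by (subst sum.swap) (simp add: y_def sum_product del: complex_cnj_mult)
    also have "\<dots> \<ge> 0"
      by (intro sum_nonneg) (simp add: less_eq_complex_def)
    finally show ?thesis .
  qed
  ultimately show ?thesis by (simp add: psd_mat_iff[OF A])
qed

section \<open>Unitary diagonalization of Hermitian matrices\<close>

lemma unitary_completion:
  fixes v :: "complex vec"
  assumes v: "v \<in> carrier_vec n" "v \<noteq> 0\<^sub>v n"
  obtains W c where "W \<in> carrier_mat n n" "mat_adjoint W * W = 1\<^sub>m n" "col W 0 = c \<cdot>\<^sub>v v"
proof -
  interpret cof_vec_space n "TYPE(complex)" .
  \<comment> \<open>A basis starting with \<open>v\<close> is orthogonalized. Gram-Schmidt keeps the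
    first vector, so \<open>ws\<close> still starts with \<open>v\<close>.\<close>
  define b where "b = basis_completion v"
  define ws where "ws = gram_schmidt n b"
  note bc = basis_completion[OF v, folded b_def]
  have n: "n \<noteq> 0" using v by (intro notI) auto
  have ws: "set ws \<subseteq> carrier_vec n" "corthogonal ws" "length ws = n"
    using gram_schmidt_result[of b ws] bc by (auto simp: ws_def)
  obtain bs where "b = v # bs" using bc n by (cases b) auto
  then have hd: "ws ! 0 = v"
    using gram_schmidt_hd[OF v(1), of bs] ws n by (metis hd_conv_nth list.size(3) ws_def)
  have wc: "ws ! i \<in> carrier_vec n" if "i < n" for i
    using ws that by auto
  \<comment> \<open>The vectors \<open>ws\<close> are orthogonal but not normalized;
    \<open>c i\<close> is the reciprocal of the norm of \<open>ws ! i\<close>. It is real, hence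
    fixed by conjugation.\<close>
  define c where "c i = complex_of_real (1 / sqrt (Re (ws ! i \<bullet>c ws ! i)))" for i
  define W where "W = mat n n (\<lambda>(i, j). c j * ws ! j $ i)"
  have W: "W \<in> carrier_mat n n" by (simp add: W_def)
  have "mat_adjoint W * W = 1\<^sub>m n"
  proof (rule eq_matI)
    fix i j assume "i < dim_row (1\<^sub>m n)" "j < dim_col (1\<^sub>m n)"
    then have ij: "i < n" "j < n" by auto
    have "(mat_adjoint W * W) $$ (i, j) = (\<Sum>k<n. cnj (c i * ws ! i $ k) * (c j * ws ! j $ k))"
      using ij W by (simp add: scalar_prod_def lessThan_atLeast0) (simp add: W_def)
    also have "\<dots> = c i * c j * (ws ! j \<bullet>c ws ! i)"
    proof -
      have "cnj (c i) = c i" by (simp add: c_def)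
      moreover have "ws ! j \<bullet>c ws ! i = (\<Sum>k<n. ws ! j $ k * cnj (ws ! i $ k))"
        using wc[OF ij(1)] by (simp add: scalar_prod_def lessThan_atLeast0)
      ultimately show ?thesis
        by (simp only: sum_distrib_left complex_cnj_mult) (simp only: mult_ac)
    qed
    also have "\<dots> = 1\<^sub>m n $$ (i, j)"
    proof (cases "i = j")
      case True
      have "0 \<le> ws ! i \<bullet>c ws ! i" "ws ! i \<bullet>c ws ! i \<noteq> 0"
        using conjugate_square_ge_0_vec[of "ws ! i"] corthogonalD[OF ws(2), of i i] ij ws by auto
      then have r: "Re (ws ! i \<bullet>c ws ! i) > 0" "ws ! i \<bullet>c ws ! i = of_real (Re (ws ! i \<bullet>c ws ! i))"
        by (auto simp: less_eq_complex_def complex_eq_iff less_le)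
      then have "(1 / sqrt (Re (ws ! i \<bullet>c ws ! i))) ^ 2 * Re (ws ! i \<bullet>c ws ! i) = 1"
        by (simp add: power_divide)
      then have "c i * c i * (ws ! i \<bullet>c ws ! i) = 1"
        unfolding c_def by (subst r(2)) (simp only: power2_eq_square flip: of_real_mult, simp)
      then show ?thesis using True ij by simp
    next
      case False
      then show ?thesis using corthogonalD[OF ws(2), of j i] ij ws by auto
    qed
    finally show "(mat_adjoint W * W) $$ (i, j) = 1\<^sub>m n $$ (i, j)" .
  qed (use W in auto)
  moreover have "col W 0 = c 0 \<cdot>\<^sub>v v"
    using n hd v by (auto simp: W_def intro!: eq_vecI)
  ultimately show ?thesis using that W by blast
qed

definition real_diag :: "nat \<Rightarrow> (nat \<Rightarrow> real) \<Rightarrow> complex mat" where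
  "real_diag n d = mat n n (\<lambda>(i, j). if i = j then complex_of_real (d i) else 0)"

lemma real_diag_carrier [simp]: "real_diag n d \<in> carrier_mat n n"
  by (simp add: real_diag_def)

lemma complex_eigenvector_exists:
  fixes A :: "complex mat"
  assumes A: "A \<in> carrier_mat n n" and "n > 0"
  obtains v e where "v \<in> carrier_vec n" "v \<noteq> 0\<^sub>v n" "A *\<^sub>v v = e \<cdot>\<^sub>v v"
proof -
  have "degree (char_poly A) = n" using degree_monic_char_poly[OF A] by simp
  then have "\<not> constant (poly (char_poly A))" using assms by (simp add: constant_degree)
  then obtain e where "poly (char_poly A) e = 0" using fundamental_theorem_of_algebra by blast
  then have "eigenvalue A e" using eigenvalue_root_char_poly[OF A] by simp
  then show ?thesis using that A by (auto simp: eigenvalue_def eigenvector_def)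
qed

text \<open>Induction on the size: conjugation by a unitary matrix whose first column is an
  eigenvector splits off a 1 by 1 block, and what remains is again Hermitian.\<close>

lemma hermitian_mat_diagonalization:
  assumes "A \<in> carrier_mat n n" "hermitian_mat A"
  shows "\<exists>U d. U \<in> carrier_mat n n \<and> mat_adjoint U * U = 1\<^sub>m n \<and>
    A = U * real_diag n d * mat_adjoint U"
  using assms
proof (induction n arbitrary: A)
  case 0
  then show ?case by (intro exI[of _ "1\<^sub>m 0"]) (auto intro!: eq_matI)
next
  case (Suc n)
  note A = \<open>A \<in> carrier_mat (Suc n) (Suc n)\<close>
  obtain v e where v: "v \<in> carrier_vec (Suc n)" "v \<noteq> 0\<^sub>v (Suc n)" and e: "A *\<^sub>v v = e \<cdot>\<^sub>v v"
    using complex_eigenvector_exists[OF A] by auto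
  obtain W c where W: "W \<in> carrier_mat (Suc n) (Suc n)" and WW: "mat_adjoint W * W = 1\<^sub>m (Suc n)"
    and W0: "col W 0 = c \<cdot>\<^sub>v v"
    using unitary_completion[OF v] .
  have aW: "mat_adjoint W \<in> carrier_mat (Suc n) (Suc n)" using W by simp
  have WW': "W * mat_adjoint W = 1\<^sub>m (Suc n)"
    using mat_mult_left_right_inverse[OF aW W WW] .
  define A' where "A' = mat_adjoint W * A * W"
  have A': "A' \<in> carrier_mat (Suc n) (Suc n)"
    unfolding A'_def using A W aW by (intro mult_carrier_mat)
  have "mat_adjoint A = A" using Suc.prems by (simp add: hermitian_mat_def)
  then have adjA': "mat_adjoint A' = A'"
    unfolding A'_def using A W aW
    by (simp add: mat_adjoint_mult[of _ "Suc n" "Suc n" _ "Suc n"] assoc_mult_mat[of _ "Suc n" "Suc n" _ "Suc n" _ "Suc n"])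
  have hA': "A' $$ (i, j) = cnj (A' $$ (j, i))" if "i < Suc n" "j < Suc n" for i j
  proof -
    have "mat_adjoint A' $$ (i, j) = cnj (A' $$ (j, i))" using A' that by simp
    then show ?thesis unfolding adjA' .
  qed
  have "A *\<^sub>v col W 0 = e \<cdot>\<^sub>v col W 0"
    unfolding W0 mult_mat_vec[OF A v(1)] e smult_smult_assoc by (simp only: mult.commute)
  note AW = this
  have W0c: "col W 0 \<in> carrier_vec (Suc n)" using W col_dim[of W 0] by auto
  \<comment> \<open>Since the first column w of \<open>W\<close> is an eigenvector, W^* A w is
    \<open>e\<close> times the first column of W^* W, the identity.\<close>
  have "col A' 0 = (mat_adjoint W * A) *\<^sub>v col W 0"
    unfolding A'_def using col_mult2[OF mult_carrier_mat[OF aW A] W, of 0] by simp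
  also have "\<dots> = mat_adjoint W *\<^sub>v (e \<cdot>\<^sub>v col W 0)"
    unfolding assoc_mult_mat_vec[OF aW A W0c] AW ..
  also have "\<dots> = e \<cdot>\<^sub>v col (mat_adjoint W * W) 0"
    using W aW by (subst mult_mat_vec) (auto simp: col_mult2[OF aW W])
  finally have col0: "col A' 0 = e \<cdot>\<^sub>v unit_vec (Suc n) 0" unfolding WW by simp
  have A'0: "A' $$ (i, 0) = (if i = 0 then e else 0)" if "i < Suc n" for i
    using arg_cong[OF col0, of "\<lambda>v :: complex Matrix.vec. v $ i"] A' that by auto
  \<comment> \<open>Symmetry carries the zeros of the first column over to the first row; on the
    diagonal it makes \<open>e\<close> real.\<close>
  have A'0': "A' $$ (0, i) = (if i = 0 then e else 0)" if "i < Suc n" for i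
    using hA'[of 0 i] hA'[of 0 0] A'0[OF that] A'0[of 0] that by auto
  have "cnj e = e" using hA'[of 0 0] A'0[of 0] by auto
  then have e: "complex_of_real (Re e) = e" by (simp add: complex_eq_iff)
  define B where "B = mat n n (\<lambda>(i, j). A' $$ (Suc i, Suc j))"
  have B: "B \<in> carrier_mat n n" by (simp add: B_def)
  have "hermitian_mat B"
    unfolding hermitian_mat_iff[OF B]
  proof (intro allI impI)
    show "B $$ (i, j) = cnj (B $$ (j, i))" if "i < n" "j < n" for i j
      using hA'[of "Suc i" "Suc j"] that by (simp only: B_def index_mat Suc_less_eq split)
  qed
  from Suc.IH[OF B this] obtain U d where U: "U \<in> carrier_mat n n" "mat_adjoint U * U = 1\<^sub>m n"
    and BU: "B = U * real_diag n d * mat_adjoint U" by blast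
  let ?E = "mat 1 1 (\<lambda>_. e)"
  \<comment> \<open>\<open>?ext X\<close> fixes the first coordinate and acts as \<open>X\<close> on
    the last \<open>n\<close>; \<open>?d\<close> puts the eigenvalue of \<open>v\<close> in front of
    those of \<open>B\<close>.\<close>
  let ?ext = "\<lambda>X. four_block_mat (1\<^sub>m 1) (0\<^sub>m 1 n) (0\<^sub>m n 1) X"
  let ?d = "case_nat (Re e) d"
  have aU: "mat_adjoint U \<in> carrier_mat n n" using U by simp
  have A'B: "A' = four_block_mat ?E (0\<^sub>m 1 n) (0\<^sub>m n 1) B"
    using A' A'0 A'0' by (auto intro!: eq_matI simp: B_def)
  have D: "real_diag (Suc n) ?d = four_block_mat ?E (0\<^sub>m 1 n) (0\<^sub>m n 1) (real_diag n d)"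
    using e by (auto intro!: eq_matI simp: real_diag_def split: nat.splits)
  have extU: "?ext U \<in> carrier_mat (Suc n) (Suc n)" "?ext (mat_adjoint U) \<in> carrier_mat (Suc n) (Suc n)"
    using U by auto
  have aext: "mat_adjoint (?ext U) = ?ext (mat_adjoint U)"
    using U by (auto intro!: eq_matI simp: mat_adjoint_index)
  have UD: "U * real_diag n d \<in> carrier_mat n n" using U by simp
  have ext1: "?ext (mat_adjoint U) * ?ext U = 1\<^sub>m (Suc n)"
    using U aU by (subst mult_four_block_mat[of _ 1 1 _ n _ n _ _ 1 _ n]) auto
  have "?ext U * real_diag (Suc n) ?d = four_block_mat ?E (0\<^sub>m 1 n) (0\<^sub>m n 1) (U * real_diag n d)"
    unfolding D using U left_mult_zero_mat[OF real_diag_carrier[of n d], of 1]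
    by (subst mult_four_block_mat[of _ 1 1 _ n _ n _ _ 1 _ n]) auto
  then have ext2: "?ext U * real_diag (Suc n) ?d * ?ext (mat_adjoint U) = A'"
    unfolding A'B BU using U aU UD right_mult_zero_mat[OF UD, of 1] left_add_zero_mat[OF mult_carrier_mat[OF UD aU]]
    by (simp, subst mult_four_block_mat[of _ 1 1 _ n _ n _ _ 1 _ n]) auto
  \<comment> \<open>Composing both changes of basis: \<open>W\<close> isolates the eigenvector, and
    the extended \<open>U\<close> diagonalizes the rest.\<close>
  let ?V = "W * ?ext U"
  note [simp] = assoc_mult_mat[of _ "Suc n" "Suc n" _ "Suc n" _ "Suc n"]
    mult_carrier_mat[of _ "Suc n" "Suc n" _ "Suc n"]
  have aV: "mat_adjoint ?V = ?ext (mat_adjoint U) * mat_adjoint W"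
    unfolding mat_adjoint_mult[OF W extU(1)] aext ..
  have "mat_adjoint ?V * ?V = ?ext (mat_adjoint U) * (mat_adjoint W * W) * ?ext U"
    unfolding aV using W aW extU by simp
  also have "\<dots> = 1\<^sub>m (Suc n)" unfolding WW right_mult_one_mat[OF extU(2)] by (rule ext1)
  finally have 1: "mat_adjoint ?V * ?V = 1\<^sub>m (Suc n)" .
  have "?V * real_diag (Suc n) ?d * mat_adjoint ?V =
      W * (?ext U * real_diag (Suc n) ?d * ?ext (mat_adjoint U)) * mat_adjoint W"
    unfolding aV using W aW extU real_diag_carrier[of "Suc n" ?d] by simp
  also have "\<dots> = (W * mat_adjoint W) * A * (W * mat_adjoint W)"
    unfolding ext2 A'_def using W aW A by simp
  also have "\<dots> = A" unfolding WW' left_mult_one_mat[OF A] right_mult_one_mat[OF A] ..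
  finally show ?case
    using 1 W extU by (intro exI[of _ ?V] exI[of _ ?d]) auto
qed

text \<open>With A = U diag(d) U^* and all d_k nonnegative, the vectors sqrt(d_k) u_k, for the
  columns u_k of U, give the rank one terms.\<close>

lemma psd_mat_decomposition:
  assumes A: "A \<in> carrier_mat n n" and psd: "psd_mat A"
  shows "\<exists>g. \<forall>i<n. \<forall>j<n. A $$ (i, j) = (\<Sum>k<n. g i k * cnj (g j k))"
proof -
  have "hermitian_mat A" using psd by (simp add: psd_mat_def)
  from hermitian_mat_diagonalization[OF A this] obtain U d where U: "U \<in> carrier_mat n n"
    "mat_adjoint U * U = 1\<^sub>m n" and AU: "A = U * real_diag n d * mat_adjoint U" by blast
  have aU: "mat_adjoint U \<in> carrier_mat n n" using U by simp
  note [simp] = assoc_mult_mat[of _ n n _ n _ n] mult_carrier_mat[of _ n n _ n]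
  have ent: "A $$ (i, j) = (\<Sum>k<n. U $$ (i, k) * of_real (d k) * cnj (U $$ (j, k)))" if "i < n" "j < n" for i j
  proof -
    let ?X = "U * real_diag n d"
    have X: "?X \<in> carrier_mat n n" using U by simp
    have "?X $$ (i, k) = U $$ (i, k) * of_real (d k)" if "k < n" for k
      using U that \<open>i < n\<close> by (simp add: scalar_prod_def real_diag_def if_distrib[of "\<lambda>x. _ * x"] cong: if_cong)
    moreover have "(?X * mat_adjoint U) $$ (i, j) = (\<Sum>k<n. ?X $$ (i, k) * cnj (U $$ (j, k)))"
      unfolding mat_mult_index[OF X aU that] using U that by (intro sum.cong) auto
    ultimately show ?thesis unfolding AU by simp
  qed
  \<comment> \<open>The eigenvalue \<open>d k\<close> is the value of the quadratic form at column
    \<open>k\<close> of \<open>U\<close>.\<close>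
  have d: "d k \<ge> 0" if k: "k < n" for k
  proof -
    have "mat_adjoint U * A * U = (mat_adjoint U * U) * real_diag n d * (mat_adjoint U * U)"
      unfolding AU using U(1) aU real_diag_carrier[of n d] by simp
    then have "mat_adjoint U * (A * U) = real_diag n d"
      unfolding U(2) left_mult_one_mat[OF real_diag_carrier] right_mult_one_mat[OF real_diag_carrier]
      using A U(1) aU by simp
    then have "of_real (d k) = (mat_adjoint U * (A * U)) $$ (k, k)"
      using k by (simp add: real_diag_def)
    also have "\<dots> = (\<Sum>i<n. \<Sum>j<n. cnj (U $$ (i, k)) * A $$ (i, j) * U $$ (j, k))"
      using A U k by (simp add: scalar_prod_def lessThan_atLeast0 sum_distrib_left mult.assoc)
    also have "\<dots> \<ge> 0" using psd[unfolded psd_mat_iff[OF A], THEN conjunct2, rule_format, of "\<lambda>i. U $$ (i, k)"] .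
    finally show ?thesis by (simp add: less_eq_complex_def)
  qed
  show ?thesis
  proof (intro exI[of _ "\<lambda>i k. U $$ (i, k) * of_real (sqrt (d k))"] allI impI)
    fix i j assume "i < n" "j < n"
    have "U $$ (i, k) * of_real (d k) * cnj (U $$ (j, k)) =
      U $$ (i, k) * of_real (sqrt (d k)) * cnj (U $$ (j, k) * of_real (sqrt (d k)))" if "k < n" for k
      using d[OF that] by (simp add: mult_ac flip: of_real_mult)
    then show "A $$ (i, j) = (\<Sum>k<n. U $$ (i, k) * of_real (sqrt (d k)) * cnj (U $$ (j, k) * of_real (sqrt (d k))))"
      unfolding ent[OF \<open>i < n\<close> \<open>j < n\<close>] by (intro sum.cong) auto
  qed
qed

section \<open>Rational functions and partial fractions\<close>

definition const_ratfun :: "complex \<Rightarrow> complex poly fract" where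
  "const_ratfun c = to_fract [:c:]"

lemma const_ratfun_mat_eq: "const_ratfun_mat A = map_mat const_ratfun A"
  by (simp add: const_ratfun_mat_def const_ratfun_def[abs_def])

interpretation const_ratfun: inj_comm_ring_hom const_ratfun
proof
  show "const_ratfun (x * y) = const_ratfun x * const_ratfun y" for x y
    by (simp add: const_ratfun_def flip: to_fract_mult)
  show "const_ratfun (x + y) = const_ratfun x + const_ratfun y" for x y
    by (simp add: const_ratfun_def flip: to_fract_add)
qed (auto simp: const_ratfun_def pCons_one)

lemma var_minus_const: "ratfun_var - const_ratfun a = to_fract [:- a, 1:]"
  by (simp add: ratfun_var_def const_ratfun_def flip: to_fract_diff)

lemma simple_fraction:
  "const_ratfun r / (ratfun_var - const_ratfun a) = to_fract [:r:] / to_fract [:- a, 1:]"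
  unfolding var_minus_const by (simp add: const_ratfun_def)

lemma var_minus_const_neq_0: "ratfun_var - const_ratfun a \<noteq> 0"
  by (simp add: var_minus_const)

lemma ratfun_eq_quotient:
  "f = to_fract (fst (quot_of_fract f)) / to_fract (snd (quot_of_fract f))"
  by (metis Fract_conv_to_fract Fract_quot_of_fract)

lemma quot_of_fract_cross:
  assumes "q \<noteq> 0"
  shows "fst (quot_of_fract (to_fract p / to_fract q)) * q =
    p * snd (quot_of_fract (to_fract p / to_fract q))" (is "fst (quot_of_fract ?f) * q = _")
proof -
  have "to_fract p / to_fract q = to_fract (fst (quot_of_fract ?f)) / to_fract (snd (quot_of_fract ?f))"
    by (rule ratfun_eq_quotient)
  then have "to_fract (fst (quot_of_fract ?f) * q) = to_fract (p * snd (quot_of_fract ?f))"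
    using assms by (simp add: frac_eq_eq)
  then show ?thesis by (simp only: to_fract_eq_iff)
qed

text \<open>By cross multiplication the reduced denominator divides the reduced numerator times
  \<open>q\<close>, and it is coprime to that numerator.\<close>

lemma snd_quot_of_fract_dvd:
  assumes "q \<noteq> 0"
  shows "snd (quot_of_fract (to_fract p / to_fract q)) dvd q"
proof -
  have "snd (quot_of_fract (to_fract p / to_fract q)) dvd fst (quot_of_fract (to_fract p / to_fract q)) * q"
    unfolding quot_of_fract_cross[OF assms] by simp
  moreover have "coprime (snd (quot_of_fract (to_fract p / to_fract q)))
      (fst (quot_of_fract (to_fract p / to_fract q)))"
    using coprime_quot_of_fract by (simp add: coprime_commute)
  ultimately show ?thesis
    by (simp add: coprime_dvd_mult_right_iff)
qed

text \<open>Evaluation is defined through lowest terms. The reduced denominator divides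
  \<open>q\<close>, so it cannot vanish at \<open>z\<close> either, and both quotients have the same
  value.\<close>

lemma eval_ratfun_quotient:
  assumes "poly q z \<noteq> 0"
  shows "eval_ratfun (to_fract p / to_fract q) z = poly p z / poly q z"
proof -
  let ?f = "to_fract p / to_fract q"
  have q: "q \<noteq> 0" using assms by auto
  have "poly (snd (quot_of_fract ?f)) z \<noteq> 0"
    using snd_quot_of_fract_dvd[OF q, of p] assms by (metis dvdE mult_zero_left poly_mult)
  moreover have "poly (fst (quot_of_fract ?f)) z * poly q z = poly p z * poly (snd (quot_of_fract ?f)) z"
    using quot_of_fract_cross[OF q, of p] by (simp flip: poly_mult)
  ultimately show ?thesis
    using assms by (simp add: eval_ratfun_def frac_eq_eq)
qed

text \<open>Evaluation is not additive at poles, where its value is 0 by convention. The induction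
  therefore carries a quotient representation whose denominator does not vanish at
  \<open>z\<close>.\<close>

lemma eval_ratfun_partial_fractions:
  assumes "finite Z" "z \<notin> Z"
  shows "eval_ratfun (const_ratfun c +
      (\<Sum>\<nu>\<in>Z. const_ratfun (r \<nu>) / (ratfun_var - const_ratfun \<nu>))) z = c + (\<Sum>\<nu>\<in>Z. r \<nu> / (z - \<nu>))"
proof -
  have "\<exists>p q. const_ratfun c + (\<Sum>\<nu>\<in>Z. const_ratfun (r \<nu>) / (ratfun_var - const_ratfun \<nu>)) =
      to_fract p / to_fract q \<and> poly q z \<noteq> 0 \<and> poly p z / poly q z = c + (\<Sum>\<nu>\<in>Z. r \<nu> / (z - \<nu>))"
    using assms
  proof (induction Z)
    case empty
    show ?case by (intro exI[of _ "[:c:]"] exI[of _ 1]) (auto simp: const_ratfun_def)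
  next
    case (insert \<nu> Z)
    then obtain p q where pq: "const_ratfun c + (\<Sum>\<nu>\<in>Z. const_ratfun (r \<nu>) / (ratfun_var - const_ratfun \<nu>)) =
      to_fract p / to_fract q" "poly q z \<noteq> 0" "poly p z / poly q z = c + (\<Sum>\<nu>\<in>Z. r \<nu> / (z - \<nu>))"
      by auto
    have q: "q \<noteq> 0" using pq(2) by auto
    have "const_ratfun c + (\<Sum>\<nu>\<in>insert \<nu> Z. const_ratfun (r \<nu>) / (ratfun_var - const_ratfun \<nu>)) =
        to_fract p / to_fract q + to_fract [:r \<nu>:] / to_fract [:- \<nu>, 1:]"
      using insert by (simp add: pq(1)[symmetric] add_ac flip: simple_fraction)
    also have "\<dots> = to_fract (p * [:- \<nu>, 1:] + [:r \<nu>:] * q) / to_fract (q * [:- \<nu>, 1:])"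
      using q by (subst add_frac_eq) (simp_all only: to_fract_add to_fract_mult, auto)
    finally have "const_ratfun c + (\<Sum>\<nu>\<in>insert \<nu> Z. const_ratfun (r \<nu>) / (ratfun_var - const_ratfun \<nu>)) = \<dots>" .
    moreover have "poly (q * [:- \<nu>, 1:]) z \<noteq> 0"
      using pq insert by auto
    moreover have "poly (p * [:- \<nu>, 1:] + [:r \<nu>:] * q) z / poly (q * [:- \<nu>, 1:]) z =
        poly p z / poly q z + r \<nu> / (z - \<nu>)"
      using pq(2) insert.prems by (subst add_frac_eq) (auto simp: algebra_simps)
    ultimately show ?case
      using insert pq(3) by (intro exI[of _ "p * [:- \<nu>, 1:] + [:r \<nu>:] * q"] exI[of _ "q * [:- \<nu>, 1:]"])
        (simp add: add_ac)
  qed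
  then show ?thesis
    using eval_ratfun_quotient by metis
qed

section \<open>Poles, orders, residues and the limit at infinity\<close>

lemma pole_at_denominator_root:
  assumes "poly (snd (quot_of_fract f)) \<nu> = 0"
  shows "is_pole (eval_ratfun f) \<nu>"
    and "zorder (eval_ratfun f) \<nu> = - int (Polynomial.order \<nu> (snd (quot_of_fract f)))"
proof -
  let ?p = "fst (quot_of_fract f)" and ?q = "snd (quot_of_fract f)"
  \<comment> \<open>In lowest terms, numerator and denominator have no common root.\<close>
  have p: "poly ?p \<nu> \<noteq> 0"
    using coprime_quot_of_fract[of f] assms by (metis coprime_poly_0)
  have ev: "eventually (\<lambda>w. w \<in> - {w. poly ?q w = 0} - {\<nu>}) (at \<nu>)"
  proof -
    have "finite ({w. poly ?q w = 0})" by (simp add: poly_roots_finite)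
    then have "open (- ({w. poly ?q w = 0} - {\<nu>}))" by (intro open_Compl finite_imp_closed finite_Diff)
    from eventually_at_in_open[OF this, of \<nu>] show ?thesis
      by (auto elim!: eventually_mono)
  qed
  have "filterlim (poly ?q) (at 0) (at \<nu>)"
    unfolding filterlim_at
  proof (intro conjI)
    show "eventually (\<lambda>w. poly ?q w \<in> UNIV \<and> poly ?q w \<noteq> 0) (at \<nu>)"
      using ev by (auto elim: eventually_mono)
    have "isCont (poly ?q) \<nu>" by simp
    then show "(poly ?q \<longlongrightarrow> 0) (at \<nu>)" using assms by (simp add: isCont_def)
  qed
  then show "is_pole (eval_ratfun f) \<nu>"
    unfolding eval_ratfun_def[abs_def] using p by (intro is_pole_divide) auto
  \<comment> \<open>Splitting off the root with its multiplicity leaves a cofactor \<open>q\<close>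
    that is nonzero at \<nu>. On \<open>?S\<close>, which omits only the roots of \<open>q\<close>,
    the quotient of \<open>?p\<close> by \<open>q\<close> is holomorphic; it is nonzero at \<nu>, so
    the order is minus the multiplicity.\<close>
  obtain q where q: "?q = [:- \<nu>, 1:] ^ Polynomial.order \<nu> ?q * q" "\<not> [:- \<nu>, 1:] dvd q"
    using order_decomp[of ?q \<nu>] by auto
  let ?S = "- {w. poly q w = 0}"
  have q\<nu>: "poly q \<nu> \<noteq> 0" using q(2) by (simp add: poly_eq_0_iff_dvd)
  then have "q \<noteq> 0" by auto
  then have "finite {w. poly q w = 0}" by (simp add: poly_roots_finite)
  then have op: "open ?S" by (intro open_Compl finite_imp_closed)
  show "zorder (eval_ratfun f) \<nu> = - int (Polynomial.order \<nu> ?q)"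
  proof (rule zorder_eqI[OF op])
    show "(\<lambda>w. poly ?p w / poly q w) holomorphic_on ?S"
      by (intro holomorphic_intros) auto
    show "eval_ratfun f w = poly ?p w / poly q w * (w - \<nu>) powi (- int (Polynomial.order \<nu> ?q))"
      if "w \<in> ?S" "w \<noteq> \<nu>" for w
    proof -
      have "poly ?q w = (w - \<nu>) ^ Polynomial.order \<nu> ?q * poly q w"
        by (subst q(1)) simp
      then show ?thesis
        by (simp add: eval_ratfun_def power_int_minus field_simps)
    qed
  qed (use p q\<nu> in auto)
qed

lemma pole_imp_denominator_root:
  assumes "is_pole (eval_ratfun f) \<nu>"
  shows "poly (snd (quot_of_fract f)) \<nu> = 0"
proof (rule ccontr)
  assume "poly (snd (quot_of_fract f)) \<nu> \<noteq> 0"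
  then have "(eval_ratfun f \<longlongrightarrow> eval_ratfun f \<nu>) (at \<nu>)"
    unfolding eval_ratfun_def by (intro tendsto_intros)
  then show False
    using assms not_tendsto_and_filterlim_at_infinity[of "at \<nu>" "eval_ratfun f"]
    by (auto simp: is_pole_def)
qed

text \<open>The terms at the other points form a function \<open>g\<close> holomorphic near \<nu>,
  and f(w) = h(w) / (w - \<nu>) with \<open>h \<nu> = r \<nu>\<close>. Residue and order are read
  off from \<open>h\<close>; if \<open>r \<nu> = 0\<close>, only \<open>g\<close> is left and there
  is no pole.\<close>

lemma partial_fractions_at_point:
  assumes Z: "finite Z" and "\<nu> \<in> Z"
    and f: "f = const_ratfun c + (\<Sum>\<mu>\<in>Z. const_ratfun (r \<mu>) / (ratfun_var - const_ratfun \<mu>))"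
  shows "residue (eval_ratfun f) \<nu> = r \<nu>"
    and "is_pole (eval_ratfun f) \<nu> \<longleftrightarrow> r \<nu> \<noteq> 0"
    and "is_pole (eval_ratfun f) \<nu> \<Longrightarrow> zorder (eval_ratfun f) \<nu> = - 1"
proof -
  define g where "g w = c + (\<Sum>\<mu>\<in>Z - {\<nu>}. r \<mu> / (w - \<mu>))" for w
  define h where "h w = r \<nu> + g w * (w - \<nu>)" for w
  let ?S = "- (Z - {\<nu>})"
  have op: "open ?S" "\<nu> \<in> ?S" using Z by (auto intro!: finite_imp_closed open_Compl simp del: Compl_Diff_eq)
  have g: "g holomorphic_on ?S"
    unfolding g_def[abs_def] by (intro holomorphic_intros) auto
  then have h: "h holomorphic_on ?S"
    unfolding h_def[abs_def] by (intro holomorphic_intros)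
  have eq: "eval_ratfun f w = r \<nu> / (w - \<nu>) + g w" if "w \<in> ?S" "w \<noteq> \<nu>" for w
  proof -
    have "eval_ratfun f w = c + (\<Sum>\<mu>\<in>Z. r \<mu> / (w - \<mu>))"
      unfolding f using that by (intro eval_ratfun_partial_fractions Z) auto
    also have "\<dots> = r \<nu> / (w - \<nu>) + g w"
      unfolding g_def using assms by (subst sum.remove[of Z \<nu>]) auto
    finally show ?thesis .
  qed
  have eq': "eval_ratfun f w = h w / (w - \<nu>)" if "w \<in> ?S" "w \<noteq> \<nu>" for w
    using eq[OF that] that by (simp add: h_def field_simps)
  have h\<nu>: "h \<nu> = r \<nu>" by (simp add: h_def)
  have ev: "eventually (\<lambda>w. w \<in> ?S - {\<nu>}) (at \<nu>)"
    using eventually_at_in_open[OF op] .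
  have ev': "eventually (\<lambda>w. eval_ratfun f w = h w / (w - \<nu>)) (at \<nu>)"
    using ev by (rule eventually_mono) (use eq' in auto)
  show "residue (eval_ratfun f) \<nu> = r \<nu>"
    using residue_cong[OF ev' refl] residue_simple[OF op h] h\<nu> by simp
  have cont: "isCont h \<nu>" "isCont g \<nu>"
    using h g op holomorphic_on_imp_continuous_on continuous_on_eq_continuous_at by blast+
  show pole: "is_pole (eval_ratfun f) \<nu> \<longleftrightarrow> r \<nu> \<noteq> 0"
  proof
    assume "r \<nu> \<noteq> 0"
    then have "is_pole (\<lambda>w. h w / (w - \<nu>)) \<nu>"
      using cont h\<nu> by (intro is_pole_divide) (auto intro!: filterlim_atI tendsto_eq_intros simp: eventually_at_filter)
    then show "is_pole (eval_ratfun f) \<nu>"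
      using is_pole_cong[OF ev' refl] by simp
  next
    assume p: "is_pole (eval_ratfun f) \<nu>"
    show "r \<nu> \<noteq> 0"
    proof
      assume r: "r \<nu> = 0"
      have "eventually (\<lambda>w. eval_ratfun f w = g w) (at \<nu>)"
        using ev by (rule eventually_mono) (use eq r in auto)
      then have "is_pole g \<nu>" using is_pole_cong p by blast
      moreover have "(g \<longlongrightarrow> g \<nu>) (at \<nu>)" using cont by (simp add: isCont_def)
      ultimately show False
        unfolding is_pole_def using not_tendsto_and_filterlim_at_infinity[of "at \<nu>" g] by auto
    qed
  qed
  assume "is_pole (eval_ratfun f) \<nu>"
  then have "h \<nu> \<noteq> 0" using pole h\<nu> by simp
  then show "zorder (eval_ratfun f) \<nu> = - 1"
    using zorder_eqI[OF op h, of "eval_ratfun f" "-1"] eq' by (simp add: power_int_minus divide_inverse)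
qed

lemma residue_partial_fractions:
  assumes Z: "finite Z"
    and f: "f = const_ratfun c + (\<Sum>\<mu>\<in>Z. const_ratfun (r \<mu>) / (ratfun_var - const_ratfun \<mu>))"
  shows "residue (eval_ratfun f) \<nu> = (if \<nu> \<in> Z then r \<nu> else 0)"
    and "is_pole (eval_ratfun f) \<nu> \<longleftrightarrow> \<nu> \<in> Z \<and> r \<nu> \<noteq> 0"
    and "is_pole (eval_ratfun f) \<nu> \<Longrightarrow> zorder (eval_ratfun f) \<nu> = - 1"
    and "(eval_ratfun f \<longlongrightarrow> c) at_infinity"
proof -
  \<comment> \<open>A point outside \<open>Z\<close> is added with coefficient 0, so that the
    analysis at a point of the index set applies to every \<nu>.\<close>
  let ?r = "\<lambda>\<mu>. if \<mu> \<in> Z then r \<mu> else 0"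
  have f': "f = const_ratfun c + (\<Sum>\<mu>\<in>insert \<nu> Z. const_ratfun (?r \<mu>) / (ratfun_var - const_ratfun \<mu>))"
    unfolding f using Z by (auto intro!: sum.mono_neutral_cong_left)
  note * = partial_fractions_at_point[OF _ _ f', of \<nu>]
  show "residue (eval_ratfun f) \<nu> = (if \<nu> \<in> Z then r \<nu> else 0)"
    "is_pole (eval_ratfun f) \<nu> \<longleftrightarrow> \<nu> \<in> Z \<and> r \<nu> \<noteq> 0"
    "is_pole (eval_ratfun f) \<nu> \<Longrightarrow> zorder (eval_ratfun f) \<nu> = - 1"
    using * Z by (auto split: if_splits)
  have "((\<lambda>w. c + (\<Sum>\<mu>\<in>Z. r \<mu> / (w - \<mu>))) \<longlongrightarrow> c + (\<Sum>\<mu>\<in>Z. 0)) at_infinity"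
    using tendsto_add_filterlim_at_infinity'[OF filterlim_ident tendsto_const, of "- \<mu>" for \<mu>]
    by (intro tendsto_intros tendsto_divide_0[OF tendsto_const]) simp
  moreover have "eventually (\<lambda>w. c + (\<Sum>\<mu>\<in>Z. r \<mu> / (w - \<mu>)) = eval_ratfun f w) at_infinity"
  proof -
    \<comment> \<open>Outside a disc containing \<open>Z\<close> the evaluation is given by the
      partial fraction formula.\<close>
    have "bounded Z" using Z by (rule finite_imp_bounded)
    then obtain B where B: "\<And>x. x \<in> Z \<Longrightarrow> norm x \<le> B" unfolding bounded_iff by auto
    then have "w \<notin> Z" if "norm w \<ge> B + 1" for w using that by fastforce
    then show ?thesis
      unfolding eventually_at_infinity f
      by (intro exI[of _ "B + 1"]) (auto intro!: eval_ratfun_partial_fractions[symmetric] Z)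
  qed
  ultimately show "(eval_ratfun f \<longlongrightarrow> c) at_infinity"
    using Lim_transform_eventually by fastforce
qed

section \<open>Existence of partial fractions\<close>

lemma partial_fractions_distinct_roots:
  assumes "finite Z" "degree p \<le> card Z"
  shows "\<exists>c r. to_fract p / to_fract (\<Prod>\<nu>\<in>Z. [:- \<nu>, 1:]) =
    const_ratfun c + (\<Sum>\<nu>\<in>Z. const_ratfun (r \<nu>) / (ratfun_var - const_ratfun \<nu>))"
  using assms
proof (induction Z arbitrary: p)
  case empty
  then obtain c where "p = [:c:]" by (auto elim: degree_eq_zeroE)
  then show ?case by (auto simp: const_ratfun_def)
next
  case (insert a Z)
  let ?q = "\<Prod>\<nu>\<in>Z. [:- \<nu>, 1:]"
  \<comment> \<open>The coefficient at \<open>a\<close>, chosen so that \<open>p\<close> minus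
    \<open>ra\<close> times the remaining product vanishes at \<open>a\<close>. Dividing by the
    linear factor then lowers the degree bound by one, as the induction hypothesis requires.\<close>
  define ra where "ra = poly p a / poly ?q a"
  have qa: "poly ?q a \<noteq> 0" using insert by (auto simp: poly_prod)
  have q0: "?q \<noteq> 0" by (simp add: insert)
  have degq: "degree ?q = card Z" by (subst degree_prod_eq_sum_degree) (auto simp: insert)
  have "poly (p - Polynomial.smult ra ?q) a = 0" using qa by (simp add: ra_def)
  then obtain p' where p': "p - Polynomial.smult ra ?q = [:- a, 1:] * p'"
    unfolding poly_eq_0_iff_dvd by (auto elim: dvdE)
  have "degree (p - Polynomial.smult ra ?q) \<le> Suc (card Z)"
    using insert degq by (intro degree_diff_le) (auto intro: order.trans[OF degree_smult_le])
  then have "degree p' \<le> card Z"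
    unfolding p' by (cases "p' = 0") (auto simp: degree_mult_eq simp del: mult_pCons_left)
  from insert.IH[OF this] obtain c r where cr: "to_fract p' / to_fract ?q =
    const_ratfun c + (\<Sum>\<nu>\<in>Z. const_ratfun (r \<nu>) / (ratfun_var - const_ratfun \<nu>))" by auto
  have "p = [:ra:] * ?q + [:- a, 1:] * p'"
    unfolding p'[symmetric] by simp
  then have "to_fract p = to_fract [:ra:] * to_fract ?q + to_fract [:- a, 1:] * to_fract p'"
    by (simp only: flip: to_fract_mult to_fract_add)
  then have "to_fract p / to_fract (\<Prod>\<nu>\<in>insert a Z. [:- \<nu>, 1:]) =
      to_fract p' / to_fract ?q + to_fract [:ra:] / to_fract [:- a, 1:]"
    using insert q0 by (simp add: field_simps del: mult_pCons_left)
  then have "to_fract p / to_fract (\<Prod>\<nu>\<in>insert a Z. [:- \<nu>, 1:]) =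
      const_ratfun c + (\<Sum>\<nu>\<in>insert a Z. const_ratfun ((r(a := ra)) \<nu>) / (ratfun_var - const_ratfun \<nu>))"
    unfolding cr using insert by (auto simp: add_ac simp flip: simple_fraction intro!: sum.cong)
  then show ?case by blast
qed

text \<open>If all poles are simple, the reduced denominator is squarefree, hence its leading
  coefficient times a product of distinct linear factors. Points of \<open>Z\<close> that are not
  poles get coefficient 0.\<close>

lemma partial_fractions_simple_poles:
  assumes f: "proper_ratfun f"
    and poles: "\<And>\<nu>. is_pole (eval_ratfun f) \<nu> \<Longrightarrow> zorder (eval_ratfun f) \<nu> = - 1 \<and> \<nu> \<in> Z"
    and Z: "finite Z"
  obtains c r where "f = const_ratfun c + (\<Sum>\<nu>\<in>Z. const_ratfun (r \<nu>) / (ratfun_var - const_ratfun \<nu>))"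
proof -
  let ?p = "fst (quot_of_fract f)" and ?q = "snd (quot_of_fract f)"
  let ?P = "{\<nu>. poly ?q \<nu> = 0}"
  \<comment> \<open>The multiplicity of a root of the denominator is minus the order of the pole
    there, hence 1.\<close>
  have "rsquarefree ?q"
    unfolding rsquarefree_def using pole_at_denominator_root[of f] poles Polynomial.order_root[of ?q]
    by (metis nat_int of_nat_1 add.inverse_inverse snd_quot_of_fract_nonzero)
  from complex_poly_decompose_rsquarefree[OF this]
  have q: "Polynomial.smult (lead_coeff ?q) (\<Prod>\<nu>\<in>?P. [:- \<nu>, 1:]) = ?q" .
  have l: "lead_coeff ?q \<noteq> 0" by simp
  have P: "finite ?P" "?P \<subseteq> Z" using pole_at_denominator_root[of f] poles by (auto simp: poly_roots_finite)
  have "degree (\<Prod>\<nu>\<in>?P. [:- \<nu>, 1:]) = card ?P"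
    by (subst degree_prod_eq_sum_degree) (auto)
  then have "degree ?q = card ?P" using q l by (metis degree_smult_eq)
  then have "degree (Polynomial.smult (inverse (lead_coeff ?q)) ?p) \<le> card ?P"
    using f unfolding proper_ratfun_def by simp
  from partial_fractions_distinct_roots[OF P(1) this] obtain c r where
    cr: "to_fract (Polynomial.smult (inverse (lead_coeff ?q)) ?p) / to_fract (\<Prod>\<nu>\<in>?P. [:- \<nu>, 1:]) =
      const_ratfun c + (\<Sum>\<nu>\<in>?P. const_ratfun (r \<nu>) / (ratfun_var - const_ratfun \<nu>))" by auto
  have "f = to_fract ?p / to_fract (Polynomial.smult (lead_coeff ?q) (\<Prod>\<nu>\<in>?P. [:- \<nu>, 1:]))"
    unfolding q by (rule ratfun_eq_quotient)
  also have "\<dots> = to_fract (Polynomial.smult (inverse (lead_coeff ?q)) ?p) / to_fract (\<Prod>\<nu>\<in>?P. [:- \<nu>, 1:])"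
  proof -
    have "?p * (\<Prod>\<nu>\<in>?P. [:- \<nu>, 1:]) = Polynomial.smult (inverse (lead_coeff ?q)) ?p * Polynomial.smult (lead_coeff ?q) (\<Prod>\<nu>\<in>?P. [:- \<nu>, 1:])"
      using l by simp
    then show ?thesis
      using q l P by (subst frac_eq_eq) (auto simp flip: to_fract_mult)
  qed
  also note cr
  also have "(\<Sum>\<nu>\<in>?P. const_ratfun (r \<nu>) / (ratfun_var - const_ratfun \<nu>)) =
      (\<Sum>\<nu>\<in>Z. const_ratfun (if \<nu> \<in> ?P then r \<nu> else 0) / (ratfun_var - const_ratfun \<nu>))"
    using Z P by (intro sum.mono_neutral_cong_left) auto
  finally show ?thesis by (rule that)
qed

section \<open>Realizations\<close>

lemma const_ratfun_mat_carrier [simp]: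
  "const_ratfun_mat A \<in> carrier_mat n m \<longleftrightarrow> A \<in> carrier_mat n m"
  by (simp add: const_ratfun_mat_def)

lemma const_ratfun_mat_index [simp]:
  "i < dim_row A \<Longrightarrow> j < dim_col A \<Longrightarrow> const_ratfun_mat A $$ (i, j) = const_ratfun (A $$ (i, j))"
  by (simp add: const_ratfun_mat_eq)

lemma resolvent_carrier:
  "F \<in> carrier_mat m m \<Longrightarrow> ratfun_var \<cdot>\<^sub>m 1\<^sub>m m - const_ratfun_mat F \<in> carrier_mat m m"
  by (intro minus_carrier_mat) simp

text \<open>The matrix is the image of \<open>char_poly_matrix F\<close>, so its determinant is the
  image of a monic polynomial and nonzero.\<close>

lemma resolvent_inverse:
  fixes F :: "complex mat"
  assumes F: "F \<in> carrier_mat m m"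
  obtains B where "mat_inverse (ratfun_var \<cdot>\<^sub>m 1\<^sub>m m - const_ratfun_mat F) = Some B" "B \<in> carrier_mat m m"
    "B * (ratfun_var \<cdot>\<^sub>m 1\<^sub>m m - const_ratfun_mat F) = 1\<^sub>m m"
    "(ratfun_var \<cdot>\<^sub>m 1\<^sub>m m - const_ratfun_mat F) * B = 1\<^sub>m m"
proof -
  let ?P = "ratfun_var \<cdot>\<^sub>m 1\<^sub>m m - const_ratfun_mat F"
  interpret to_fract: inj_comm_ring_hom "to_fract :: complex poly \<Rightarrow> _"
    by unfold_locales auto
  have P: "?P \<in> carrier_mat m m" using F by (rule resolvent_carrier)
  have "?P = map_mat to_fract (char_poly_matrix F)"
    using F by (intro eq_matI)
      (auto simp: char_poly_matrix_def const_ratfun_mat_def ratfun_var_def simp flip: to_fract_diff to_fract_uminus)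
  then have "det ?P = to_fract (char_poly F)"
    by (simp add: char_poly_def)
  moreover have "char_poly F \<noteq> 0"
    using degree_monic_char_poly[OF F] by auto
  ultimately have "det ?P \<noteq> 0" by simp
  then have "mat_inverse ?P \<noteq> None"
    using det_non_zero_imp_unit[OF P, of "()"] mat_inverse(1)[OF P, of "()"] by blast
  then obtain B where "mat_inverse ?P = Some B" by auto
  with mat_inverse(2)[OF P this] show ?thesis using that by blast
qed

text \<open>Multiplying the equation by the inverse shows that \<open>X\<close> is that inverse
  times D. A reduction can thus be found by solving a linear system, without computing the
  inverse.\<close>

lemma isospectral_reduction_eq:
  assumes M: "submatrix A S S \<in> carrier_mat s s" and C: "submatrix A S (- S) \<in> carrier_mat s m"
    and D: "submatrix A (- S) S \<in> carrier_mat m s" and F: "submatrix A (- S) (- S) \<in> carrier_mat m m"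
    and X: "X \<in> carrier_mat m s"
    and eq: "(ratfun_var \<cdot>\<^sub>m 1\<^sub>m m - const_ratfun_mat (submatrix A (- S) (- S))) * X =
      const_ratfun_mat (submatrix A (- S) S)"
  shows "isospectral_reduction S A =
    const_ratfun_mat (submatrix A S S) + const_ratfun_mat (submatrix A S (- S)) * X"
proof -
  let ?P = "ratfun_var \<cdot>\<^sub>m 1\<^sub>m m - const_ratfun_mat (submatrix A (- S) (- S))"
  let ?C = "const_ratfun_mat (submatrix A S (- S))" and ?D = "const_ratfun_mat (submatrix A (- S) S)"
  obtain B where B: "mat_inverse ?P = Some B" "B \<in> carrier_mat m m" "B * ?P = 1\<^sub>m m"
    using resolvent_inverse[OF F] by metis
  have P: "?P \<in> carrier_mat m m" using F by (rule resolvent_carrier)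
  have C': "?C \<in> carrier_mat s m" using C by simp
  have D': "?D \<in> carrier_mat m s" using D by simp
  have "B * ?D = X"
    unfolding eq[symmetric] assoc_mult_mat[OF B(2) P X, symmetric] B(3) using X by simp
  then have "?C * B * ?D = ?C * X"
    unfolding assoc_mult_mat[OF C' B(2) D'] by simp
  moreover have "dim_row (const_ratfun_mat (submatrix A (- S) (- S))) = m"
    using F by (simp add: const_ratfun_mat_def)
  ultimately show ?thesis
    by (simp add: isospectral_reduction_def Let_def B(1))
qed

text \<open>The rows of \<open>X\<close> are the states: multiplication by \<lambda> acts on them
  through \<open>F\<close>, with the constant rows of \<open>D\<close> as input.\<close>

lemma resolvent_equation_iff:
  assumes F: "F \<in> carrier_mat m m" and D: "D \<in> carrier_mat m s" and X: "X \<in> carrier_mat m s"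
  shows "(ratfun_var \<cdot>\<^sub>m 1\<^sub>m m - const_ratfun_mat F) * X = const_ratfun_mat D \<longleftrightarrow>
    (\<forall>a<m. \<forall>j<s. ratfun_var * X $$ (a, j) =
      (\<Sum>b<m. const_ratfun (F $$ (a, b)) * X $$ (b, j)) + const_ratfun (D $$ (a, j)))"
proof -
  let ?P = "ratfun_var \<cdot>\<^sub>m 1\<^sub>m m - const_ratfun_mat F"
  have P: "?P \<in> carrier_mat m m" using F by (rule resolvent_carrier)
  have D': "const_ratfun_mat D \<in> carrier_mat m s" using D by simp
  have *: "(?P * X) $$ (a, j) = ratfun_var * X $$ (a, j) - (\<Sum>b<m. const_ratfun (F $$ (a, b)) * X $$ (b, j))"
    if "a < m" "j < s" for a j
  proof -
    have "(?P * X) $$ (a, j) = (\<Sum>b<m. (if a = b then ratfun_var * X $$ (b, j) else 0) -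
        const_ratfun (F $$ (a, b)) * X $$ (b, j))"
      unfolding mat_mult_index[OF P X that] using F that
      by (intro sum.cong) (auto simp: const_ratfun_mat_eq algebra_simps)
    then show ?thesis using that by (simp add: sum_subtractf)
  qed
  have "?P * X = const_ratfun_mat D \<longleftrightarrow>
      (\<forall>a<m. \<forall>j<s. (?P * X) $$ (a, j) = const_ratfun_mat D $$ (a, j))"
    using D' mult_carrier_mat[OF P X] by (metis carrier_matD eq_matI)
  also have "\<dots> \<longleftrightarrow> (\<forall>a<m. \<forall>j<s. ratfun_var * X $$ (a, j) =
      (\<Sum>b<m. const_ratfun (F $$ (a, b)) * X $$ (b, j)) + const_ratfun (D $$ (a, j)))"
    using D by (intro all_cong1 imp_cong refl) (simp add: * algebra_simps)
  finally show ?thesis .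
qed

section \<open>Block matrices, state equations and unfoldings\<close>

lemma pick_lessThan: "i < s \<Longrightarrow> pick {..<s} i = i"
  using pick_card_in_set[of i "{..<s}"]
  by (metis (no_types, lifting) Collect_cong card_Collect_less_nat lessThan_iff order_less_trans)

lemma pick_atLeast: "pick {s..} i = s + i"
proof -
  have "{a \<in> {s..}. a < s + i} = {s..<s + i}" by auto
  then show ?thesis using pick_card_in_set[of "s + i" "{s..}"] by simp
qed

lemma submatrix_four_block_mat:
  assumes "M \<in> carrier_mat s s" "C \<in> carrier_mat s m" "D \<in> carrier_mat m s" "F \<in> carrier_mat m m"
  defines "A \<equiv> four_block_mat M C D F"
  shows "submatrix A {..<s} {..<s} = M" "submatrix A {..<s} (- {..<s}) = C"
    "submatrix A (- {..<s}) {..<s} = D" "submatrix A (- {..<s}) (- {..<s}) = F"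
proof -
  have "{i. i < s + m \<and> i \<in> {..<s}} = {..<s}" "{i. i < s + m \<and> i \<in> - {..<s}} = {s..<s + m}"
    by auto
  then have card: "card {i. i < s + m \<and> i \<in> {..<s}} = s" "card {i. i < s + m \<and> i \<in> - {..<s}} = m"
    by simp_all
  have dim: "dim_row A = s + m" "dim_col A = s + m" using assms by auto
  show "submatrix A {..<s} {..<s} = M" "submatrix A {..<s} (- {..<s}) = C"
    "submatrix A (- {..<s}) {..<s} = D" "submatrix A (- {..<s}) (- {..<s}) = F"
    unfolding submatrix_def dim card
    using assms by (auto intro!: eq_matI simp: pick_lessThan pick_atLeast)
qed

text \<open>Reduces the construction of an unfolding to state equations and a readout. With
  \<open>m > 0\<close> the block matrix is strictly larger than \<open>R\<close>, as
  \<open>is_unfolding\<close> demands.\<close>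

lemma unfolding_of_realization:
  assumes blocks: "M \<in> carrier_mat s s" "C \<in> carrier_mat s m" "D \<in> carrier_mat m s" "F \<in> carrier_mat m m"
    and "m > 0" and R: "R \<in> carrier_mat s s" and X: "X \<in> carrier_mat m s"
    and state: "\<And>a j. a < m \<Longrightarrow> j < s \<Longrightarrow> ratfun_var * X $$ (a, j) =
      (\<Sum>b<m. const_ratfun (F $$ (a, b)) * X $$ (b, j)) + const_ratfun (D $$ (a, j))"
    and readout: "\<And>i j. i < s \<Longrightarrow> j < s \<Longrightarrow> R $$ (i, j) =
      const_ratfun (M $$ (i, j)) + (\<Sum>b<m. const_ratfun (C $$ (i, b)) * X $$ (b, j))"
  shows "is_unfolding R (four_block_mat M C D F) {..<s}"
proof -
  let ?A = "four_block_mat M C D F"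
  note sub = submatrix_four_block_mat[OF blocks]
  have "(ratfun_var \<cdot>\<^sub>m 1\<^sub>m m - const_ratfun_mat F) * X = const_ratfun_mat D"
    unfolding resolvent_equation_iff[OF blocks(4,3) X] using state by blast
  then have iso: "isospectral_reduction {..<s} ?A = const_ratfun_mat M + const_ratfun_mat C * X"
    using isospectral_reduction_eq[of ?A "{..<s}" s m X] X blocks unfolding sub by blast
  have C: "const_ratfun_mat C \<in> carrier_mat s m" using blocks by simp
  have "const_ratfun_mat M + const_ratfun_mat C * X = R"
  proof (rule eq_matI)
    fix i j assume "i < dim_row R" "j < dim_col R"
    then have ij: "i < s" "j < s" using R by auto
    then have "(const_ratfun_mat M + const_ratfun_mat C * X) $$ (i, j) =
        const_ratfun (M $$ (i, j)) + (const_ratfun_mat C * X) $$ (i, j)"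
      using blocks X by (simp add: const_ratfun_mat_eq del: index_mult_mat(1))
    also have "\<dots> = R $$ (i, j)"
      unfolding mat_mult_index[OF C X ij] readout[OF ij] using blocks ij by (simp add: const_ratfun_mat_eq)
    finally show "(const_ratfun_mat M + const_ratfun_mat C * X) $$ (i, j) = R $$ (i, j)" .
  qed (use R X blocks in \<open>auto simp: const_ratfun_mat_def\<close>)
  then show ?thesis
    unfolding is_unfolding_def using iso R \<open>m > 0\<close> blocks
    by (intro exI[of _ "s + m"]) auto
qed

text \<open>The states are the rows of the inverse of \<lambda>I - F times D. The index set
  \<open>S\<close> is arbitrary, so the entries of the blocks are located through
  \<open>pick\<close>; as \<open>A\<close> is Hermitian, D is the adjoint of \<open>C\<close> and is
  replaced by it.\<close>

lemma realization_of_hermitian_unfolding: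
  assumes R: "R \<in> carrier_mat s s" and unf: "is_unfolding R A S" and herm: "hermitian_mat A"
  obtains M C m F X where "M \<in> carrier_mat s s" "hermitian_mat M" "C \<in> carrier_mat s m"
    "F \<in> carrier_mat m m" "hermitian_mat F" "X \<in> carrier_mat m s"
    "\<forall>a<m. \<forall>j<s. ratfun_var * X $$ (a, j) =
      (\<Sum>b<m. const_ratfun (F $$ (a, b)) * X $$ (b, j)) + const_ratfun (cnj (C $$ (j, a)))"
    "\<forall>i<s. \<forall>j<s. R $$ (i, j) =
      const_ratfun (M $$ (i, j)) + (\<Sum>b<m. const_ratfun (C $$ (i, b)) * X $$ (b, j))"
proof -
  from unf R obtain n where A: "A \<in> carrier_mat n n" and S: "S \<subseteq> {..<n}" "card S = s"
    and iso: "isospectral_reduction S A = R"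
    unfolding is_unfolding_def by auto
  have hA: "A $$ (i, j) = cnj (A $$ (j, i))" if "i < n" "j < n" for i j
    using herm that unfolding hermitian_mat_iff[OF A] by blast
  define m where "m = card {i. i < n \<and> i \<in> - S}"
  have "{i. i < n \<and> i \<in> S} = S" using S by auto
  then have s: "card {i. i < n \<and> i \<in> S} = s" using S by simp
  define M C D F where "M = submatrix A S S" and "C = submatrix A S (- S)"
    and "D = submatrix A (- S) S" and "F = submatrix A (- S) (- S)"
  note defs = M_def C_def D_def F_def
  have carr: "M \<in> carrier_mat s s" "C \<in> carrier_mat s m" "D \<in> carrier_mat m s" "F \<in> carrier_mat m m"
    unfolding defs submatrix_def using A s m_def by auto
  have pick: "pick S i < n" if "i < s" for i using pick_le[of i n S] s that by simp
  have pick': "pick (- S) i < n" if "i < m" for i using pick_le[of i n "- S"] that by (simp add: m_def)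
  have idx: "M $$ (i, j) = A $$ (pick S i, pick S j)" if "i < s" "j < s" for i j
    unfolding defs using A s that by (intro submatrix_index) auto
  have idxC: "C $$ (i, j) = A $$ (pick S i, pick (- S) j)" if "i < s" "j < m" for i j
    unfolding defs using A s that by (intro submatrix_index) (auto simp: m_def)
  have idxD: "D $$ (i, j) = A $$ (pick (- S) i, pick S j)" if "i < m" "j < s" for i j
    unfolding defs using A s that by (intro submatrix_index) (auto simp: m_def)
  have idxF: "F $$ (i, j) = A $$ (pick (- S) i, pick (- S) j)" if "i < m" "j < m" for i j
    unfolding defs using A s that by (intro submatrix_index) (auto simp: m_def)
  have hM: "hermitian_mat M"
    unfolding hermitian_mat_iff[OF carr(1)]
  proof (intro allI impI)
    show "M $$ (i, j) = cnj (M $$ (j, i))" if "i < s" "j < s" for i j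
      unfolding idx[OF that] idx[OF that(2,1)] by (intro hA pick that)
  qed
  have hF: "hermitian_mat F"
    unfolding hermitian_mat_iff[OF carr(4)]
  proof (intro allI impI)
    show "F $$ (i, j) = cnj (F $$ (j, i))" if "i < m" "j < m" for i j
      unfolding idxF[OF that] idxF[OF that(2,1)] by (intro hA pick' that)
  qed
  have DC: "D $$ (a, j) = cnj (C $$ (j, a))" if "a < m" "j < s" for a j
    unfolding idxD[OF that] idxC[OF that(2,1)] by (intro hA pick pick' that)
  let ?P = "ratfun_var \<cdot>\<^sub>m 1\<^sub>m m - const_ratfun_mat F"
  have P: "?P \<in> carrier_mat m m" using carr(4) by (rule resolvent_carrier)
  have cD: "const_ratfun_mat D \<in> carrier_mat m s" and cC: "const_ratfun_mat C \<in> carrier_mat s m"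
    using carr by simp_all
  obtain B where B: "B \<in> carrier_mat m m" "?P * B = 1\<^sub>m m"
    using resolvent_inverse[OF carr(4)] by metis
  define X where "X = B * const_ratfun_mat D"
  have X: "X \<in> carrier_mat m s" using B cD by (simp add: X_def)
  have eq: "?P * X = const_ratfun_mat D"
    unfolding X_def assoc_mult_mat[OF P B(1) cD, symmetric] B(2) using cD by simp
  have state: "ratfun_var * X $$ (a, j) =
      (\<Sum>b<m. const_ratfun (F $$ (a, b)) * X $$ (b, j)) + const_ratfun (cnj (C $$ (j, a)))"
    if "a < m" "j < s" for a j
    using eq that unfolding resolvent_equation_iff[OF carr(4,3) X] by (simp add: DC)
  have RX: "R = const_ratfun_mat M + const_ratfun_mat C * X"
    using isospectral_reduction_eq[of A S s m X] carr X eq iso unfolding defs by simp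
  have readout: "R $$ (i, j) =
      const_ratfun (M $$ (i, j)) + (\<Sum>b<m. const_ratfun (C $$ (i, b)) * X $$ (b, j))"
    if ij: "i < s" "j < s" for i j
  proof -
    have "R $$ (i, j) = const_ratfun (M $$ (i, j)) + (const_ratfun_mat C * X) $$ (i, j)"
      unfolding RX using carr X ij by (simp add: const_ratfun_mat_eq del: index_mult_mat(1))
    then show ?thesis
      unfolding mat_mult_index[OF cC X ij] using carr ij by (simp add: const_ratfun_mat_eq)
  qed
  show ?thesis using that[OF carr(1) hM carr(2) carr(4) hF X] state readout by blast
qed

section \<open>Realization of an arbitrary proper matrix\<close>

text \<open>An index below \<open>d * s\<close> encodes the pair of its quotient and remainder
  modulo \<open>s\<close>; fixing the remainder leaves a sum over the quotient.\<close>

lemma sum_mod_eq: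
  fixes g :: "nat \<Rightarrow> 'a :: comm_monoid_add"
  assumes "j < s"
  shows "(\<Sum>b<d * s. if b mod s = j then g b else 0) = (\<Sum>k<d. g (k * s + j))"
proof -
  have "(\<Sum>b<d * s. if b mod s = j then g b else 0) = (\<Sum>b\<in>{b. b < d * s \<and> b mod s = j}. g b)"
    by (auto simp: sum.If_cases Int_def intro: sum.cong)
  also have "\<dots> = (\<Sum>k<d. g (k * s + j))"
  proof (rule sum.reindex_bij_witness[where i = "\<lambda>k. k * s + j" and j = "\<lambda>b. b div s"])
    fix k assume "k \<in> {..<d}"
    then have "Suc k * s \<le> d * s" by (intro mult_le_mono1) auto
    then show "k * s + j \<in> {b. b < d * s \<and> b mod s = j}" using assms by auto
  qed (use assms in \<open>auto simp: less_mult_imp_div_less\<close>)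
  finally show ?thesis .
qed

lemma common_denominator:
  assumes "finite I" and "\<And>i. i \<in> I \<Longrightarrow> proper_ratfun (f i)"
  obtains q p where "q \<noteq> 0" "degree q > 0"
    "\<And>i. i \<in> I \<Longrightarrow> f i = to_fract (p i) / to_fract q \<and> degree (p i) \<le> degree q"
proof -
  \<comment> \<open>The factor \<open>\<lambda>\<close> makes the degree positive even if all denominators are constant.\<close>
  define q where "q = [:0, 1:] * (\<Prod>i\<in>I. snd (quot_of_fract (f i)))"
  have "(\<Prod>i\<in>I. snd (quot_of_fract (f i))) \<noteq> 0" using assms(1) by simp
  then have q: "q \<noteq> 0" "degree q > 0" by (auto simp: q_def degree_mult_eq simp del: mult_pCons_left)
  have "\<exists>p. f i = to_fract p / to_fract q \<and> degree p \<le> degree q" if "i \<in> I" for i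
  proof -
    let ?n = "fst (quot_of_fract (f i))" and ?d = "snd (quot_of_fract (f i))"
    have "?d dvd q" unfolding q_def using that assms(1) by (intro dvd_mult dvd_prodI)
    then obtain k where k: "q = ?d * k" by (elim dvdE)
    then have "k \<noteq> 0" using q by auto
    \<comment> \<open>Expanding a fraction by \<open>k\<close> adds \<open>degree k\<close> above
      and below, so properness is kept.\<close>
    have "degree (?n * k) \<le> degree ?n + degree k" by (rule degree_mult_le)
    also have "\<dots> \<le> degree ?d + degree k" using assms(2)[OF that] by (simp add: proper_ratfun_def)
    also have "\<dots> = degree q" unfolding k using \<open>k \<noteq> 0\<close> by (subst degree_mult_eq) auto
    finally have "degree (?n * k) \<le> degree q" .
    moreover have "to_fract (?n * k) / to_fract q = to_fract ?n / to_fract ?d"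
      by (subst k) (use \<open>k \<noteq> 0\<close> in simp)
    ultimately show ?thesis using ratfun_eq_quotient[of "f i"] by metis
  qed
  then show ?thesis using that q by metis
qed

lemma unfolding_exists:
  assumes s: "s \<ge> 1" and R: "R \<in> carrier_mat s s"
    and proper: "\<And>i j. i < s \<Longrightarrow> j < s \<Longrightarrow> proper_ratfun (R $$ (i, j))"
  shows "\<exists>A S. is_unfolding R A S"
proof -
  obtain q p' where q: "q \<noteq> 0" "degree q > 0"
    and p': "\<And>x. x \<in> {..<s} \<times> {..<s} \<Longrightarrow> R $$ x = to_fract (p' x) / to_fract q \<and> degree (p' x) \<le> degree q"
    using common_denominator[of "{..<s} \<times> {..<s}" "\<lambda>x. R $$ x"] proper
    by (metis (no_types, lifting) SigmaE finite_SigmaI finite_lessThan lessThan_iff)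
  define p where "p i j = p' (i, j)" for i j
  have p: "R $$ (i, j) = to_fract (p i j) / to_fract q" "degree (p i j) \<le> degree q"
    if "i < s" "j < s" for i j
    using p'[of "(i, j)"] that by (auto simp: p_def)
  define d where "d = degree q"
  define l where "l = lead_coeff q"
  have l: "l \<noteq> 0" using q by (simp add: l_def)
  \<comment> \<open>The basic states \<lambda>^k / q. Multiplication by \<lambda> shifts the index,
    and a fraction over \<open>q\<close> with numerator of degree at most \<open>d\<close> is a
    combination of \<open>x 0\<close> to \<open>x d\<close>.\<close>
  define x where "x k = to_fract (monom 1 k) / to_fract q" for k
  have var_x: "ratfun_var * x k = x (Suc k)" for k
    by (simp add: x_def ratfun_var_def monom_Suc flip: to_fract_mult)
  have expand: "to_fract r / to_fract q = (\<Sum>k\<le>d. const_ratfun (coeff r k) * x k)"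
    if "degree r \<le> d" for r
  proof -
    have "to_fract r = to_fract (\<Sum>k\<le>d. monom (coeff r k) k)"
      using that by (simp add: poly_as_sum_of_monoms')
    also have "\<dots> = (\<Sum>k\<le>d. const_ratfun (coeff r k) * to_fract (monom 1 k))"
      by (simp add: const_ratfun_def smult_monom flip: to_fract_mult)
    finally show ?thesis by (simp add: x_def sum_divide_distrib)
  qed
  \<comment> \<open>Expanding \<open>q\<close> itself gives a linear relation between 1 and the
    \<open>x k\<close>. Solved for \<open>x d\<close>, it closes the shift within the
    \<open>x k\<close> with \<open>k < d\<close> and the constants.\<close>
  have "1 = to_fract q / to_fract q" using q by simp
  also have "\<dots> = const_ratfun l * x d + (\<Sum>k<d. const_ratfun (coeff q k) * x k)"
    by (subst expand) (simp_all add: d_def l_def flip: lessThan_Suc_atMost)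
  finally have "const_ratfun (1 / l) = const_ratfun (1 / l) *
    (const_ratfun l * x d + (\<Sum>k<d. const_ratfun (coeff q k) * x k))" by simp
  then have "const_ratfun (1 / l) = x d + (\<Sum>k<d. const_ratfun (coeff q k / l) * x k)"
    using l by (simp add: distrib_left sum_distrib_left mult.assoc[symmetric] flip: const_ratfun.hom_mult)
  then have xd: "x d = (\<Sum>k<d. const_ratfun (- coeff q k / l) * x k) + const_ratfun (1 / l)"
    by (simp add: sum_negf const_ratfun.hom_uminus)
  \<comment> \<open>With \<open>x d\<close> eliminated, the constant part becomes the entry of
    \<open>M\<close> and the coefficients of the states become entries of \<open>C\<close>.\<close>
  have p_expand: "to_fract r / to_fract q = const_ratfun (coeff r d / l) +
      (\<Sum>k<d. const_ratfun (coeff r k - coeff r d * coeff q k / l) * x k)" if "degree r \<le> d" for r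
  proof -
    have "to_fract r / to_fract q = const_ratfun (coeff r d) * x d + (\<Sum>k<d. const_ratfun (coeff r k) * x k)"
      unfolding expand[OF that] by (simp flip: lessThan_Suc_atMost)
    also have "const_ratfun (coeff r d) * x d = const_ratfun (coeff r d / l) -
        (\<Sum>k<d. const_ratfun (coeff r d * coeff q k / l) * x k)"
      unfolding xd by (simp add: distrib_left right_diff_distrib sum_distrib_left mult.assoc[symmetric] sum_negf const_ratfun.hom_uminus flip: const_ratfun.hom_mult)
    finally show ?thesis
      by (simp add: const_ratfun.hom_minus algebra_simps sum_subtractf)
  qed
  \<comment> \<open>State \<open>a\<close> is x_(a div s) times the unit row with index a mod s: one
    copy of the basic states for each of the \<open>s\<close> columns.\<close>
  define m where "m = d * s"
  define X where "X = mat m s (\<lambda>(a, j). if a mod s = j then x (a div s) else 0)"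
  \<comment> \<open>Companion matrix of \<open>q\<close> divided by its leading coefficient: the
    last row holds the coefficients in \<open>xd\<close>, the others shift. The constant
    \<open>1 / l\<close> of \<open>xd\<close> enters through \<open>D\<close>, in the last row of
    each copy.\<close>
  define f where "f k k' = (if Suc k < d then if k' = Suc k then 1 else 0 else - coeff q k' / l)" for k k'
  define F where "F = mat m m (\<lambda>(a, b). if a mod s = b mod s then f (a div s) (b div s) else 0)"
  define D where "D = mat m s (\<lambda>(a, j). if a mod s = j \<and> Suc (a div s) = d then 1 / l else 0)"
  define M where "M = mat s s (\<lambda>(i, j). coeff (p i j) d / l)"
  define C where "C = mat s m (\<lambda>(i, b). coeff (p i (b mod s)) (b div s) -
    coeff (p i (b mod s)) d * coeff q (b div s) / l)"
  have "is_unfolding R (four_block_mat M C D F) {..<s}"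
  proof (rule unfolding_of_realization[OF _ _ _ _ _ R, where X = X])
    show "m > 0" using s q by (simp add: m_def d_def)
    fix a j assume aj: "a < m" "j < s"
    have a: "a div s < d" using aj by (auto simp: m_def less_mult_imp_div_less)
    have "(\<Sum>b<m. const_ratfun (F $$ (a, b)) * X $$ (b, j)) =
      (\<Sum>b<d * s. if b mod s = j then const_ratfun (if a mod s = j then f (a div s) (b div s) else 0) * x (b div s) else 0)"
      unfolding m_def[symmetric] using aj by (intro sum.cong) (auto simp: F_def X_def)
    also have "\<dots> = (\<Sum>k<d. const_ratfun (if a mod s = j then f (a div s) k else 0) * x k)"
      by (subst sum_mod_eq) (use aj s in \<open>auto intro!: sum.cong\<close>)
    finally have FX: "(\<Sum>b<m. const_ratfun (F $$ (a, b)) * X $$ (b, j)) =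
      (if a mod s = j then \<Sum>k<d. const_ratfun (f (a div s) k) * x k else 0)" by simp
    have step: "(\<Sum>k<d. const_ratfun (f (a div s) k) * x k) + const_ratfun (if Suc (a div s) = d then 1 / l else 0) =
      x (Suc (a div s))"
    proof (cases "Suc (a div s) = d")
      case True
      then show ?thesis using xd by (simp add: f_def)
    next
      case False
      then have "Suc (a div s) < d" using a by simp
      then show ?thesis
        using False by (simp add: f_def if_distrib[of const_ratfun] if_distrib[of "\<lambda>z. z * _"] cong: if_cong)
    qed
    show "ratfun_var * X $$ (a, j) =
      (\<Sum>b<m. const_ratfun (F $$ (a, b)) * X $$ (b, j)) + const_ratfun (D $$ (a, j))"
      unfolding FX using aj step by (auto simp: X_def D_def var_x)
  next
    fix i j assume ij: "i < s" "j < s"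
    have "(\<Sum>b<m. const_ratfun (C $$ (i, b)) * X $$ (b, j)) =
      (\<Sum>b<d * s. if b mod s = j then const_ratfun (coeff (p i j) (b div s) - coeff (p i j) d * coeff q (b div s) / l) * x (b div s) else 0)"
      unfolding m_def[symmetric] using ij by (intro sum.cong) (auto simp: C_def X_def)
    also have "\<dots> = (\<Sum>k<d. const_ratfun (coeff (p i j) k - coeff (p i j) d * coeff q k / l) * x k)"
      by (subst sum_mod_eq) (use ij in auto)
    finally show "R $$ (i, j) = const_ratfun (M $$ (i, j)) + (\<Sum>b<m. const_ratfun (C $$ (i, b)) * X $$ (b, j))"
      using p[OF ij] p_expand[of "p i j"] ij by (simp add: M_def d_def)
  qed (auto simp: M_def C_def D_def F_def X_def)
  then show ?thesis by blast
qed

section \<open>Hermitian unfoldings\<close>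

lemma hermitian_unfolding_partial_fractions:
  assumes R: "R \<in> carrier_mat s s" and "is_unfolding R A S" "hermitian_mat A"
  obtains M g d and m :: nat where "M \<in> carrier_mat s s" "hermitian_mat M"
    "\<forall>i<s. \<forall>j<s. R $$ (i, j) = const_ratfun (M $$ (i, j)) +
      (\<Sum>k<m. const_ratfun (g i k * cnj (g j k)) / (ratfun_var - const_ratfun (complex_of_real (d k))))"
proof -
  obtain M C m F X where M: "M \<in> carrier_mat s s" "hermitian_mat M" and C: "C \<in> carrier_mat s m"
    and F: "F \<in> carrier_mat m m" "hermitian_mat F" and X: "X \<in> carrier_mat m s"
    and state: "\<forall>a<m. \<forall>j<s. ratfun_var * X $$ (a, j) =
      (\<Sum>b<m. const_ratfun (F $$ (a, b)) * X $$ (b, j)) + const_ratfun (cnj (C $$ (j, a)))"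
    and readout: "\<forall>i<s. \<forall>j<s. R $$ (i, j) =
      const_ratfun (M $$ (i, j)) + (\<Sum>b<m. const_ratfun (C $$ (i, b)) * X $$ (b, j))"
    by (rule realization_of_hermitian_unfolding[OF assms])
  obtain U d where U: "U \<in> carrier_mat m m" and UU: "mat_adjoint U * U = 1\<^sub>m m"
    and FU: "F = U * real_diag m d * mat_adjoint U"
    using hermitian_mat_diagonalization[OF F] by blast
  have aU: "mat_adjoint U \<in> carrier_mat m m" using U by simp
  have UU': "U * mat_adjoint U = 1\<^sub>m m" using mat_mult_left_right_inverse[OF aU U UU] .
  have DU: "real_diag m d * mat_adjoint U \<in> carrier_mat m m"
    using real_diag_carrier aU by (rule mult_carrier_mat)
  have "mat_adjoint U * F = (mat_adjoint U * U) * (real_diag m d * mat_adjoint U)"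
    unfolding FU assoc_mult_mat[OF U real_diag_carrier aU] assoc_mult_mat[OF aU U DU] ..
  then have aUF: "mat_adjoint U * F = real_diag m d * mat_adjoint U"
    unfolding UU left_mult_one_mat[OF DU] .
  \<comment> \<open>The conjugated columns of \<open>U\<close> are left eigenvectors of
    \<open>F\<close>.\<close>
  have eig: "(\<Sum>a<m. cnj (U $$ (a, k)) * F $$ (a, b)) = of_real (d k) * cnj (U $$ (b, k))"
    if "k < m" "b < m" for k b
  proof -
    have "(\<Sum>a<m. cnj (U $$ (a, k)) * F $$ (a, b)) = (mat_adjoint U * F) $$ (k, b)"
      unfolding mat_mult_index[OF aU F(1) that] using U that by (intro sum.cong) auto
    also have "\<dots> = (\<Sum>a<m. (if k = a then of_real (d a) * cnj (U $$ (b, a)) else 0))"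
      unfolding aUF mat_mult_index[OF real_diag_carrier aU that] using U that
      by (intro sum.cong) (auto simp: real_diag_def)
    finally show ?thesis using that by simp
  qed
  have unit: "(\<Sum>k<m. U $$ (a, k) * cnj (U $$ (b, k))) = (if a = b then 1 else 0)"
    if "a < m" "b < m" for a b
  proof -
    have "(\<Sum>k<m. U $$ (a, k) * cnj (U $$ (b, k))) = (U * mat_adjoint U) $$ (a, b)"
      unfolding mat_mult_index[OF U aU that] using U that by (intro sum.cong) auto
    then show ?thesis unfolding UU' using that by simp
  qed
  \<comment> \<open>This is C U. As the input block is the adjoint of \<open>C\<close>, the input of
    the state \<open>k\<close> in eigenvector coordinates is the conjugate of column
    \<open>k\<close> of \<open>g\<close>; this is why the numerators have rank one.\<close>
  define g where "g i k = (\<Sum>a<m. C $$ (i, a) * U $$ (a, k))" for i k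
  \<comment> \<open>The states U^* X in eigenvector coordinates. Their equations decouple, so each
    is a constant divided by \<lambda> - d_k.\<close>
  define Y where "Y k j = (\<Sum>a<m. const_ratfun (cnj (U $$ (a, k))) * X $$ (a, j))" for k j
  have Y: "Y k j = const_ratfun (cnj (g j k)) / (ratfun_var - const_ratfun (of_real (d k)))"
    if kj: "k < m" "j < s" for k j
  proof -
    have "ratfun_var * Y k j = (\<Sum>a<m. const_ratfun (cnj (U $$ (a, k))) * (ratfun_var * X $$ (a, j)))"
      by (simp add: Y_def sum_distrib_left mult_ac)
    also have "\<dots> = (\<Sum>a<m. \<Sum>b<m. const_ratfun (cnj (U $$ (a, k)) * F $$ (a, b)) * X $$ (b, j)) +
        (\<Sum>a<m. const_ratfun (cnj (U $$ (a, k)) * cnj (C $$ (j, a))))"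
      using kj by (simp add: state distrib_left sum.distrib sum_distrib_left mult.assoc const_ratfun.hom_mult)
    also have "(\<Sum>a<m. \<Sum>b<m. const_ratfun (cnj (U $$ (a, k)) * F $$ (a, b)) * X $$ (b, j)) =
        (\<Sum>b<m. const_ratfun (\<Sum>a<m. cnj (U $$ (a, k)) * F $$ (a, b)) * X $$ (b, j))"
      by (subst sum.swap) (simp add: const_ratfun.hom_sum sum_distrib_right)
    also have "\<dots> = const_ratfun (of_real (d k)) * Y k j"
      using kj by (simp add: eig Y_def sum_distrib_left const_ratfun.hom_mult mult.assoc)
    also have "(\<Sum>a<m. const_ratfun (cnj (U $$ (a, k)) * cnj (C $$ (j, a)))) = const_ratfun (cnj (g j k))"
      by (simp add: g_def const_ratfun.hom_sum mult.commute)
    finally have "(ratfun_var - const_ratfun (of_real (d k))) * Y k j = const_ratfun (cnj (g j k))"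
      by (simp add: left_diff_distrib)
    then show ?thesis using var_minus_const_neq_0 by (simp add: nonzero_eq_divide_eq mult.commute)
  qed
  \<comment> \<open>The change of coordinates is inverted by U U^* = I.\<close>
  have XY: "X $$ (b, j) = (\<Sum>k<m. const_ratfun (U $$ (b, k)) * Y k j)" if "b < m" "j < s" for b j
  proof -
    have "(\<Sum>k<m. const_ratfun (U $$ (b, k)) * Y k j) =
        (\<Sum>a<m. const_ratfun (\<Sum>k<m. U $$ (b, k) * cnj (U $$ (a, k))) * X $$ (a, j))"
      unfolding Y_def sum_distrib_left
      by (subst sum.swap) (simp add: const_ratfun.hom_sum const_ratfun.hom_mult sum_distrib_right mult.assoc)
    also have "\<dots> = (\<Sum>a<m. if b = a then X $$ (a, j) else 0)"
      using that by (intro sum.cong) (auto simp: unit)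
    finally show ?thesis using that by simp
  qed
  have "R $$ (i, j) = const_ratfun (M $$ (i, j)) +
      (\<Sum>k<m. const_ratfun (g i k * cnj (g j k)) / (ratfun_var - const_ratfun (complex_of_real (d k))))"
    if ij: "i < s" "j < s" for i j
  proof -
    have "(\<Sum>b<m. const_ratfun (C $$ (i, b)) * X $$ (b, j)) =
        (\<Sum>b<m. \<Sum>k<m. const_ratfun (C $$ (i, b) * U $$ (b, k)) * Y k j)"
      using ij by (intro sum.cong refl) (simp add: XY sum_distrib_left const_ratfun.hom_mult mult.assoc)
    also have "\<dots> = (\<Sum>k<m. const_ratfun (g i k) * Y k j)"
      by (subst sum.swap) (simp add: g_def const_ratfun.hom_sum sum_distrib_right)
    also have "\<dots> = (\<Sum>k<m. const_ratfun (g i k * cnj (g j k)) / (ratfun_var - const_ratfun (of_real (d k))))"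
      using ij by (intro sum.cong refl) (simp add: Y const_ratfun.hom_mult)
    finally show ?thesis unfolding readout[rule_format, OF ij] by simp
  qed
  then show ?thesis using that M by blast
qed

lemma hermitian_unfolding_necessary:
  assumes R: "R \<in> carrier_mat s s" and unf: "is_unfolding R A S" "hermitian_mat A"
  shows "\<forall>i j \<nu>. entry_pole R i j \<nu> \<longrightarrow> \<nu> \<in> \<real> \<and> zorder (eval_ratfun (R $$ (i, j))) \<nu> = - 1"
    and "\<forall>i j \<nu>. entry_pole R i j \<nu> \<longrightarrow> psd_mat (residue_mat R \<nu>)"
    and "\<exists>L. mat_limit_at_infinity R L \<and> hermitian_mat L"
proof -
  obtain M g d and m :: nat where M: "M \<in> carrier_mat s s" "hermitian_mat M"
    and Rg: "\<forall>i<s. \<forall>j<s. R $$ (i, j) = const_ratfun (M $$ (i, j)) +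
      (\<Sum>k<m. const_ratfun (g i k * cnj (g j k)) / (ratfun_var - const_ratfun (complex_of_real (d k))))"
    by (rule hermitian_unfolding_partial_fractions[OF assms])
  \<comment> \<open>Several \<open>k\<close> may share an eigenvalue. Grouping them by
    \<open>K \<nu>\<close> makes the points distinct, and the residue matrix at \<nu> becomes a Gram
    matrix over \<open>K \<nu>\<close>.\<close>
  define Z where "Z = (\<lambda>k. complex_of_real (d k)) ` {..<m}"
  define K where "K \<nu> = {k \<in> {..<m}. complex_of_real (d k) = \<nu>}" for \<nu>
  define r where "r i j \<nu> = (\<Sum>k\<in>K \<nu>. g i k * cnj (g j k))" for i j \<nu>
  have Z: "finite Z" "Z \<subseteq> \<real>" by (auto simp: Z_def)
  have Rr: "R $$ (i, j) = const_ratfun (M $$ (i, j)) +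
      (\<Sum>\<nu>\<in>Z. const_ratfun (r i j \<nu>) / (ratfun_var - const_ratfun \<nu>))" if "i < s" "j < s" for i j
  proof -
    have "(\<Sum>k<m. const_ratfun (g i k * cnj (g j k)) / (ratfun_var - const_ratfun (complex_of_real (d k)))) =
      (\<Sum>\<nu>\<in>Z. \<Sum>k\<in>K \<nu>. const_ratfun (g i k * cnj (g j k)) / (ratfun_var - const_ratfun (complex_of_real (d k))))"
      unfolding Z_def K_def by (rule sum.image_gen) simp
    also have "\<dots> = (\<Sum>\<nu>\<in>Z. const_ratfun (r i j \<nu>) / (ratfun_var - const_ratfun \<nu>))"
      by (intro sum.cong refl) (simp add: r_def K_def const_ratfun.hom_sum sum_divide_distrib)
    finally show ?thesis unfolding Rg[rule_format, OF that] by simp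
  qed
  note analysis = residue_partial_fractions[OF Z(1) Rr]
  show "\<forall>i j \<nu>. entry_pole R i j \<nu> \<longrightarrow> \<nu> \<in> \<real> \<and> zorder (eval_ratfun (R $$ (i, j))) \<nu> = - 1"
    using analysis(2,3) Z(2) R unfolding entry_pole_def by fastforce
  show "\<forall>i j \<nu>. entry_pole R i j \<nu> \<longrightarrow> psd_mat (residue_mat R \<nu>)"
  proof (intro allI impI)
    fix i j \<nu> assume "entry_pole R i j \<nu>"
    then have "\<nu> \<in> Z" using analysis(2) R unfolding entry_pole_def by auto
    then have "residue_mat R \<nu> $$ (i, j) = (\<Sum>k\<in>K \<nu>. g i k * cnj (g j k))" if "i < s" "j < s" for i j
      using analysis(1)[OF that] R that by (simp add: residue_mat_def r_def)
    moreover have "residue_mat R \<nu> \<in> carrier_mat s s" using R by (simp add: residue_mat_def)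
    ultimately show "psd_mat (residue_mat R \<nu>)"
      by (intro psd_mat_gram[where K = "K \<nu>"]) (auto simp: K_def)
  qed
  show "\<exists>L. mat_limit_at_infinity R L \<and> hermitian_mat L"
    using analysis(4) M R unfolding mat_limit_at_infinity_def by blast
qed

text \<open>All entries are expanded over one set \<open>Z\<close> of real points. The coefficients
  are then the limit and the residue matrices, and each residue matrix splits into \<open>s\<close>
  rank one terms that supply the states.\<close>

lemma hermitian_unfolding_sufficient:
  assumes s: "s \<ge> 1" and R: "R \<in> carrier_mat s s"
    and proper: "\<And>i j. i < s \<Longrightarrow> j < s \<Longrightarrow> proper_ratfun (R $$ (i, j))"
    and simple: "\<And>i j \<nu>. entry_pole R i j \<nu> \<Longrightarrow> \<nu> \<in> \<real> \<and> zorder (eval_ratfun (R $$ (i, j))) \<nu> = - 1"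
    and psd: "\<And>i j \<nu>. entry_pole R i j \<nu> \<Longrightarrow> psd_mat (residue_mat R \<nu>)"
    and L: "mat_limit_at_infinity R L" "hermitian_mat L"
  shows "\<exists>A S. is_unfolding R A S \<and> hermitian_mat A"
proof -
  \<comment> \<open>The point \<open>0\<close> is added so that there is a state even if \<open>R\<close> has no poles.\<close>
  define Z where "Z = insert 0 (\<Union>i<s. \<Union>j<s. {\<nu>. poly (snd (quot_of_fract (R $$ (i, j)))) \<nu> = 0 \<and> entry_pole R i j \<nu>})"
  have Z: "finite Z" "0 \<in> Z" "Z \<subseteq> \<real>"
    using simple by (auto simp: Z_def intro!: finite_subset[OF _ poly_roots_finite])
  have Lc: "L \<in> carrier_mat s s" using L R by (simp add: mat_limit_at_infinity_def)
  define P where "P = residue_mat R"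
  have Pc: "P \<nu> \<in> carrier_mat s s" for \<nu> using R by (simp add: P_def residue_mat_def)
  have "\<exists>c r. R $$ (i, j) = const_ratfun c + (\<Sum>\<nu>\<in>Z. const_ratfun (r \<nu>) / (ratfun_var - const_ratfun \<nu>))"
    if ij: "i < s" "j < s" for i j
  proof -
    have "zorder (eval_ratfun (R $$ (i, j))) \<nu> = - 1 \<and> \<nu> \<in> Z" if "is_pole (eval_ratfun (R $$ (i, j))) \<nu>" for \<nu>
    proof -
      have e: "entry_pole R i j \<nu>" using that ij R by (simp add: entry_pole_def)
      moreover have "poly (snd (quot_of_fract (R $$ (i, j)))) \<nu> = 0"
        using that by (rule pole_imp_denominator_root)
      ultimately show ?thesis using simple[OF e] ij by (auto simp: Z_def)
    qed
    then show ?thesis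
      using partial_fractions_simple_poles[OF proper[OF ij] _ Z(1)] by metis
  qed
  then obtain c r where Rc: "\<And>i j. i < s \<Longrightarrow> j < s \<Longrightarrow> R $$ (i, j) = const_ratfun (c i j) +
      (\<Sum>\<nu>\<in>Z. const_ratfun (r i j \<nu>) / (ratfun_var - const_ratfun \<nu>))"
    by metis
  note analysis = residue_partial_fractions[OF Z(1) Rc]
  \<comment> \<open>The coefficients are determined: at the points of \<open>Z\<close> by the
    residues, and the constant by uniqueness of the limit.\<close>
  have rP: "r i j \<nu> = P \<nu> $$ (i, j)" if "i < s" "j < s" "\<nu> \<in> Z" for i j \<nu>
    using analysis(1)[OF that(1,2), of \<nu>] R that by (simp add: P_def residue_mat_def)
  have cL: "c i j = L $$ (i, j)" if "i < s" "j < s" for i j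
    using analysis(4)[OF that] L(1) R that tendsto_unique[OF trivial_limit_at_infinity]
    unfolding mat_limit_at_infinity_def by blast
  \<comment> \<open>Where no entry has a pole, as may happen at the added point 0, the residue
    matrix is zero.\<close>
  have "psd_mat (P \<nu>)" if "\<nu> \<in> Z" for \<nu>
  proof (cases "\<exists>i j. entry_pole R i j \<nu>")
    case True
    then show ?thesis using psd by (auto simp: P_def)
  next
    case False
    then have "P \<nu> $$ (i, j) = 0" if "i < s" "j < s" for i j
      using analysis(2)[OF that, of \<nu>] rP[OF that \<open>\<nu> \<in> Z\<close>] R that \<open>\<nu> \<in> Z\<close> by (auto simp: entry_pole_def)
    then show ?thesis by (intro psd_mat_gram[OF Pc, of "{}"]) auto
  qed
  then have "\<exists>g. \<forall>i<s. \<forall>j<s. P \<nu> $$ (i, j) = (\<Sum>k<s. g i k * cnj (g j k))" if "\<nu> \<in> Z" for \<nu>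
    using that by (intro psd_mat_decomposition[OF Pc])
  then obtain g where g: "\<And>\<nu> i j. \<nu> \<in> Z \<Longrightarrow> i < s \<Longrightarrow> j < s \<Longrightarrow>
      P \<nu> $$ (i, j) = (\<Sum>k<s. g \<nu> i k * cnj (g \<nu> j k))"
    by metis
  \<comment> \<open>One state for each point of \<open>Z\<close> and each rank one term there;
    \<open>e\<close> numbers these pairs.\<close>
  define m where "m = card (Z \<times> {..<s})"
  have fin: "finite (Z \<times> {..<s})" using Z by simp
  have m: "m > 0" unfolding m_def using Z s fin by (subst card_gt_0_iff) (auto simp: lessThan_empty_iff)
  obtain e where e: "bij_betw e {..<m} (Z \<times> {..<s})"
    using ex_bij_betw_nat_finite[OF fin] by (auto simp: m_def lessThan_atLeast0)
  have eZ: "fst (e a) \<in> Z" if "a < m" for a using bij_betwE[OF e] that by (metis SigmaE fst_conv lessThan_iff)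
  define h where "h i a = g (fst (e a)) i (snd (e a))" for i a
  \<comment> \<open>A diagonal \<open>F\<close> with real entries from \<open>Z\<close>, and
    \<open>D\<close> the adjoint of \<open>C\<close>: together with the Hermitian \<open>L\<close>
    they form a Hermitian block matrix, and the states in \<open>X\<close> solve the decoupled
    equations.\<close>
  define F where "F = mat m m (\<lambda>(a, b). if a = b then fst (e a) else 0)"
  define C where "C = mat s m (\<lambda>(i, a). h i a)"
  define D where "D = mat m s (\<lambda>(a, j). cnj (h j a))"
  define X where "X = mat m s (\<lambda>(a, j). const_ratfun (cnj (h j a)) / (ratfun_var - const_ratfun (fst (e a))))"
  have carr: "F \<in> carrier_mat m m" "C \<in> carrier_mat s m" "D \<in> carrier_mat m s" "X \<in> carrier_mat m s"
    by (simp_all add: F_def C_def D_def X_def)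
  have "is_unfolding R (four_block_mat L C D F) {..<s}"
  proof (rule unfolding_of_realization[OF Lc carr(2,3,1) m R carr(4)])
    fix a j assume aj: "a < m" "j < s"
    have "(\<Sum>b<m. const_ratfun (F $$ (a, b)) * X $$ (b, j)) =
        (\<Sum>b<m. if a = b then const_ratfun (fst (e b)) * X $$ (b, j) else 0)"
      using aj by (intro sum.cong) (auto simp: F_def)
    also have "\<dots> = const_ratfun (fst (e a)) * X $$ (a, j)" using aj by simp
    finally have FX: "(\<Sum>b<m. const_ratfun (F $$ (a, b)) * X $$ (b, j)) = \<dots>" .
    have "(ratfun_var - const_ratfun (fst (e a))) * X $$ (a, j) = const_ratfun (D $$ (a, j))"
      using aj var_minus_const_neq_0 by (simp add: X_def D_def)
    then show "ratfun_var * X $$ (a, j) =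
        (\<Sum>b<m. const_ratfun (F $$ (a, b)) * X $$ (b, j)) + const_ratfun (D $$ (a, j))"
      unfolding FX by (simp add: algebra_simps)
  next
    fix i j assume ij: "i < s" "j < s"
    let ?t = "\<lambda>(\<nu>, k). const_ratfun (g \<nu> i k * cnj (g \<nu> j k)) / (ratfun_var - const_ratfun \<nu>)"
    have "(\<Sum>b<m. const_ratfun (C $$ (i, b)) * X $$ (b, j)) = (\<Sum>b<m. ?t (e b))"
      using ij by (intro sum.cong) (auto simp: C_def X_def h_def const_ratfun.hom_mult split: prod.splits)
    also have "\<dots> = (\<Sum>x\<in>Z \<times> {..<s}. ?t x)" using sum.reindex_bij_betw[OF e] .
    also have "\<dots> = (\<Sum>\<nu>\<in>Z. \<Sum>k<s. ?t (\<nu>, k))" by (simp add: sum.cartesian_product)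
    also have "\<dots> = (\<Sum>\<nu>\<in>Z. const_ratfun (r i j \<nu>) / (ratfun_var - const_ratfun \<nu>))"
      using ij by (intro sum.cong refl) (simp add: rP g const_ratfun.hom_sum sum_divide_distrib)
    finally show "R $$ (i, j) = const_ratfun (L $$ (i, j)) + (\<Sum>b<m. const_ratfun (C $$ (i, b)) * X $$ (b, j))"
      using Rc[OF ij] cL[OF ij] by simp
  qed
  moreover have "hermitian_mat (four_block_mat L C D F)"
  proof -
    have LL: "L $$ (i, j) = cnj (L $$ (j, i))" if "i < s" "j < s" for i j
      using L(2) that unfolding hermitian_mat_iff[OF Lc] by blast
    have FF: "F $$ (a, b) = cnj (F $$ (b, a))" if "a < m" "b < m" for a b
    proof -
      have "cnj (fst (e a)) = fst (e a)"
        using eZ[OF that(1)] Z(3) by (auto simp flip: Reals_cnj_iff)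
      then show ?thesis using that by (auto simp: F_def)
    qed
    have A: "four_block_mat L C D F \<in> carrier_mat (s + m) (s + m)" using Lc carr by simp
    show ?thesis
      unfolding hermitian_mat_iff[OF A]
    proof (intro allI impI)
      fix a b assume ab: "a < s + m" "b < s + m"
      consider "a < s" "b < s" | "a < s" "\<not> b < s" | "\<not> a < s" "b < s" | "\<not> a < s" "\<not> b < s" by blast
      then show "four_block_mat L C D F $$ (a, b) = cnj (four_block_mat L C D F $$ (b, a))"
      proof cases
        case 1
        then show ?thesis using Lc carr ab LL[of a b] by simp
      next
        case 4
        then show ?thesis using Lc carr ab FF[of "a - s" "b - s"] by simp
      qed (use Lc carr ab in \<open>auto simp: C_def D_def\<close>)
    qed
  qed
  ultimately show ?thesis by blast
qed

theorem theorem3p4: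
  fixes R :: "complex poly fract mat" and s :: nat
  assumes "s \<ge> 1"
    and "R \<in> carrier_mat s s"
    and "\<And>i j. i < s \<Longrightarrow> j < s \<Longrightarrow> proper_ratfun (R $$ (i, j))"
  shows "(\<exists>A S. is_unfolding R A S) \<and>
    ((\<exists>A S. is_unfolding R A S \<and> hermitian_mat A) \<longleftrightarrow>
      (\<forall>i j \<nu>. entry_pole R i j \<nu> \<longrightarrow>
         \<nu> \<in> \<real> \<and> zorder (eval_ratfun (R $$ (i, j))) \<nu> = - 1) \<and>
      (\<forall>i j \<nu>. entry_pole R i j \<nu> \<longrightarrow> psd_mat (residue_mat R \<nu>)) \<and>
      (\<exists>L. mat_limit_at_infinity R L \<and> hermitian_mat L))"
proof (intro conjI iffI)
  show "\<exists>A S. is_unfolding R A S"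
    using assms by (rule unfolding_exists)
  assume "\<exists>A S. is_unfolding R A S \<and> hermitian_mat A"
  then obtain A S where "is_unfolding R A S" "hermitian_mat A" by blast
  note necessary = hermitian_unfolding_necessary[OF assms(2) this]
  show "\<forall>i j \<nu>. entry_pole R i j \<nu> \<longrightarrow> \<nu> \<in> \<real> \<and> zorder (eval_ratfun (R $$ (i, j))) \<nu> = - 1"
    by (rule necessary)
  show "\<forall>i j \<nu>. entry_pole R i j \<nu> \<longrightarrow> psd_mat (residue_mat R \<nu>)"
    by (rule necessary)
  show "\<exists>L. mat_limit_at_infinity R L \<and> hermitian_mat L"
    by (rule necessary)
next
  assume conditions: "(\<forall>i j \<nu>. entry_pole R i j \<nu> \<longrightarrow>
         \<nu> \<in> \<real> \<and> zorder (eval_ratfun (R $$ (i, j))) \<nu> = - 1) \<and>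
      (\<forall>i j \<nu>. entry_pole R i j \<nu> \<longrightarrow> psd_mat (residue_mat R \<nu>)) \<and>
      (\<exists>L. mat_limit_at_infinity R L \<and> hermitian_mat L)"
  then obtain L where "mat_limit_at_infinity R L" "hermitian_mat L" by blast
  then show "\<exists>A S. is_unfolding R A S \<and> hermitian_mat A"
    using conditions by (intro hermitian_unfolding_sufficient[OF assms]) auto
qed

end
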